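(* Let $n$ be an odd positive integer. The average $2$-dimension $E(n)$ of the hulls of cyclic codes of length $n$ over $R=\mathbb{Z}_4+v\mathbb{Z}_4$, $v^2=v$, is $$E(n)=\frac{10n}{9}-\frac{4B_n}{9},\qquad\text{where } B_n=\sum_{j\mid n,\;j\in N_2}\phi(j).$$
   Context: $R=\mathbb{Z}_4[v]/\langle v^2-v\rangle=\mathbb{Z}_4+v\mathbb{Z}_4$. A linear code of length $n$ over $R$ is an $R$-submodule of $R^n$; it is cyclic if closed under the cyclic shift of coordinates. For $h,k\in R^n$, $h\cdot k=\sum_i h_ik_i$; $C^\perp=\{h\in R^n:h\cdot k=0\ \forall k\in C\}$ and $\mathrm{Hull}(C)=C\cap C^\perp$. The $2$-dimension of a code $D$ is $\dim_2(D)=\log_2|D|$. The average $2$-dimension of the hull is $$E(n)=\frac{1}{|\mathcal{C}|}\sum_{C\in\mathcal{C}}\dim_2(\mathrm{Hull}(C)),$$ where $\mathcal{C}$ is the (finite) set of all cyclic codes of length $n$ over $R$. $N_2=\{l\ge1:l\text{ divides }2^i+1\text{ for some positive integer }i\}$ and $\phi$ is Euler's function. *)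

theory Defs
  imports
    Complex_Main
    "HOL-Library.Numeral_Type"
    "HOL-Computational_Algebra.Polynomial"
    "HOL-Number_Theory.Totient"
    "Jordan_Normal_Form.VS_Connect"
begin

text \<open>
  The ring \<open>Z\<^sub>4\<close> is the type \<open>4\<close> of integers modulo 4, and
  \<open>R = Z\<^sub>4[v]/(v\<^sup>2 - v)\<close> is the type of residue classes of polynomials over it.
  Since \<open>[:0, -1, 1:]\<close> is the polynomial \<open>v\<^sup>2 - v\<close>, two polynomials are identified iff
  their difference lies in the ideal generated by it.
\<close>

quotient_type Z4v = "4 poly" / "\<lambda>p q. [:0, -1, 1:] dvd p - q"
proof (intro equivpI reflpI sympI transpI)
  fix p q r :: "4 poly"
  show "[:0, -1, 1:] dvd p - p" by simp
  show "[:0, -1, 1:] dvd q - p" if "[:0, -1, 1:] dvd p - q"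
    using that by (metis dvd_minus_iff minus_diff_eq)
  show "[:0, -1, 1:] dvd p - r" if "[:0, -1, 1:] dvd p - q" "[:0, -1, 1:] dvd q - r"
    using dvd_add[OF that] by simp
qed

instantiation Z4v :: comm_ring_1
begin

lift_definition zero_Z4v :: Z4v is 0 .
lift_definition one_Z4v :: Z4v is 1 .

lift_definition plus_Z4v :: "Z4v \<Rightarrow> Z4v \<Rightarrow> Z4v" is "(+)"
proof -
  fix p p' q q' :: "4 poly"
  assume "[:0, -1, 1:] dvd p - p'" "[:0, -1, 1:] dvd q - q'"
  from dvd_add[OF this] show "[:0, -1, 1:] dvd p + q - (p' + q')"
    by (simp add: algebra_simps)
qed

lift_definition uminus_Z4v :: "Z4v \<Rightarrow> Z4v" is uminus
  by (metis dvd_minus_iff minus_diff_minus)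

lift_definition minus_Z4v :: "Z4v \<Rightarrow> Z4v \<Rightarrow> Z4v" is "(-)"
proof -
  fix p p' q q' :: "4 poly"
  assume "[:0, -1, 1:] dvd p - p'" "[:0, -1, 1:] dvd q - q'"
  from dvd_diff[OF this] show "[:0, -1, 1:] dvd p - q - (p' - q')"
    by (simp add: algebra_simps)
qed

lift_definition times_Z4v :: "Z4v \<Rightarrow> Z4v \<Rightarrow> Z4v" is "(*)"
proof -
  fix p p' q q' :: "4 poly"
  assume "[:0, -1, 1:] dvd p - p'" "[:0, -1, 1:] dvd q - q'"
  then have "[:0, -1, 1:] dvd (p - p') * q + p' * (q - q')"
    by (intro dvd_add dvd_mult dvd_mult2)
  then show "[:0, -1, 1:] dvd p * q - p' * q'"
    by (simp add: algebra_simps)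
qed

instance
proof
  show "(0::Z4v) \<noteq> 1"
  proof (transfer, rule notI)
    assume "[:0, -1, 1:] dvd (0 - 1 :: 4 poly)"
    then obtain s :: "4 poly" where "0 - 1 = [:0, -1, 1:] * s" by (elim dvdE)
    then have "poly (0 - 1 :: 4 poly) 0 = poly ([:0, -1, 1:] * s) 0" by simp
    then show False by simp
  qed
qed (transfer; simp add: algebra_simps)+

end

lift_definition v_elem :: Z4v is "[:0, 1:]" .

lift_definition of_Z4 :: "4 \<Rightarrow> Z4v" is "\<lambda>a. [:a:]" .

lemma v_elem_idem: "v_elem * v_elem = v_elem"
  by transfer simp

lemma Z4v_repr: "\<exists>!(a, b). of_Z4 a + of_Z4 b * v_elem = x"
proof -
  have ex: "\<exists>a b. [:0, -1, 1:] dvd p - [:a, b:]" for p :: "4 poly"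
  proof (induction p)
    case 0
    have "[:0, -1, 1:] dvd 0 - ([:0, 0:] :: 4 poly)" by simp
    then show ?case by blast
  next
    case (pCons c p)
    then obtain a b where "[:0, -1, 1:] dvd p - [:a, b:]" by blast
    then have "[:0, -1, 1:] dvd [:0, 1:] * (p - [:a, b:]) + [:0, -1, 1:] * [:b:]"
      by (intro dvd_add[OF dvd_mult dvd_triv_left])
    also have "[:0, 1:] * (p - [:a, b:]) + [:0, -1, 1:] * [:b:] = pCons c p - [:c, a + b:]"
      by (cases p) simp
    finally show ?case by blast
  qed
  have uniq: "a = c \<and> b = d"
    if "[:0, -1, 1:] dvd [:a, b:] - [:c, d:]" for a b c d :: 4
  proof -
    from that obtain s where s: "[:a, b:] - [:c, d:] = [:0, -1, 1:] * s" by (elim dvdE)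
    have "poly ([:a, b:] - [:c, d:]) 0 = 0" "poly ([:a, b:] - [:c, d:]) 1 = 0"
      unfolding s by simp_all
    then show ?thesis by simp
  qed
  have "\<exists>a b. of_Z4 a + of_Z4 b * v_elem = x"
  proof transfer
    fix p :: "4 poly"
    from ex[of p] obtain a b :: 4 where "[:0, -1, 1:] dvd p - [:a, b:]" by blast
    then have "[:0, -1, 1:] dvd [:a, b:] - p" by (metis dvd_minus_iff minus_diff_eq)
    then show "\<exists>a b. [:0, -1, 1:] dvd [:a:] + [:b:] * [:0, 1:] - p" by auto
  qed
  then obtain a b where ab: "of_Z4 a + of_Z4 b * v_elem = x" by blast
  have inj: "a = c \<and> b = d" if "of_Z4 a + of_Z4 b * v_elem = of_Z4 c + of_Z4 d * v_elem" for a b c d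
    using that by transfer (use uniq in simp)
  show ?thesis
    by (rule ex1I[of _ "(a, b)"]) (use ab inj in auto)
qed

lemma bij_Z4v: "bij (\<lambda>(a, b). of_Z4 a + of_Z4 b * v_elem)"
  unfolding bij_iff case_prod_unfold
  by (intro allI Z4v_repr[unfolded case_prod_unfold])

lemma card_Z4v: "CARD(Z4v) = 16"
  using bij_betw_same_card[OF bij_Z4v] by simp

instance Z4v :: finite
  by standard (metis card_Z4v card.infinite zero_neq_numeral)

text \<open>
  Words of length \<open>n\<close> are the vectors in \<open>carrier_vec n\<close>, with coordinates numbered from 0.
\<close>

definition linear_code :: "nat \<Rightarrow> Z4v vec set \<Rightarrow> bool" where
  "linear_code n C \<longleftrightarrow> LinearCombinations.submodule class_ring C (module_vec TYPE(Z4v) n)"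

lemma linear_code_iff:
  "linear_code n C \<longleftrightarrow>
     C \<subseteq> carrier_vec n \<and> 0\<^sub>v n \<in> C \<and> (\<forall>x\<in>C. \<forall>y\<in>C. x + y \<in> C) \<and> (\<forall>r. \<forall>x\<in>C. r \<cdot>\<^sub>v x \<in> C)"
proof -
  interpret vec_module "TYPE(Z4v)" n .
  show ?thesis
    using module_axioms by (auto simp: linear_code_def LinearCombinations.submodule_def module_vec_simps)
qed

text \<open>
  \<open>(c\<^sub>0, c\<^sub>1, \<dots>) \<mapsto> (c\<^bsub>n-1\<^esub>, c\<^sub>0, \<dots>)\<close>; adding \<open>n - 1\<close> modulo \<open>n\<close> avoids truncated
  subtraction at index 0.
\<close>

definition cyclic_shift :: "'a vec \<Rightarrow> 'a vec" where
  "cyclic_shift c = vec (dim_vec c) (\<lambda>i. c $ ((i + (dim_vec c - 1)) mod dim_vec c))"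

definition cyclic_codes :: "nat \<Rightarrow> Z4v vec set set" where
  "cyclic_codes n = {C. linear_code n C \<and> (\<forall>c\<in>C. cyclic_shift c \<in> C)}"

definition dual_code :: "nat \<Rightarrow> Z4v vec set \<Rightarrow> Z4v vec set" where
  "dual_code n C = {h \<in> carrier_vec n. \<forall>k\<in>C. h \<bullet> k = 0}"

definition code_hull :: "nat \<Rightarrow> Z4v vec set \<Rightarrow> Z4v vec set" where
  "code_hull n C = C \<inter> dual_code n C"

definition dim2 :: "Z4v vec set \<Rightarrow> real" where
  "dim2 D = log 2 (real (card D))"

definition avg_hull_dim :: "nat \<Rightarrow> real" where
  "avg_hull_dim n = (\<Sum>C\<in>cyclic_codes n. dim2 (code_hull n C)) / real (card (cyclic_codes n))"

lemma finite_carrier_vec: "finite (carrier_vec n :: Z4v vec set)"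
proof -
  have "carrier_vec n \<subseteq> vec_of_list ` {xs :: Z4v list. set xs \<subseteq> UNIV \<and> length xs = n}"
    by (force intro: image_eqI[where x = "list_of_vec _"] simp: vec_list)
  then show ?thesis
    by (rule finite_subset) (intro finite_imageI finite_lists_length_eq finite)
qed

lemma finite_cyclic_codes: "finite (cyclic_codes n)"
  by (rule finite_subset[of _ "Pow (carrier_vec n)"])
     (auto simp: cyclic_codes_def linear_code_iff finite_carrier_vec)

definition N2 :: "nat set" where
  "N2 = {l. l \<ge> 1 \<and> (\<exists>i::nat. i > 0 \<and> l dvd 2 ^ i + 1)}"

definition B_sum :: "nat \<Rightarrow> nat" where
  "B_sum n = (\<Sum>j | j dvd n \<and> j \<in> N2. totient j)"

end

theory Submission
  imports
    Defs
    "HOL-Library.FuncSet"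
    "HOL-Number_Theory.Residues"
    "Berlekamp_Zassenhaus.Berlekamp_Type_Based"
begin

text \<open>
  Cyclic codes of length \<open>n\<close> are the ideals of \<open>A = R[x]/(x\<^sup>n - 1)\<close>, and duality becomes
  \<open>I \<mapsto> \<sigma>(Ann I)\<close> for the involution \<open>\<sigma> : x \<mapsto> x\<^sup>-\<^sup>1\<close>. As \<open>n\<close> is odd, \<open>A\<close> is a product of local rings
  \<open>Ae\<close>, \<open>e\<close> a primitive idempotent, each with exactly the three ideals \<open>0\<close>, \<open>2Ae\<close>, \<open>Ae\<close> and with
  \<open>|Ae| = 4\<^bsup>d\<^esup>\<close>, \<open>d = d(e)\<close>. So an ideal is a function \<open>g\<close> from the primitive idempotents to
  \<open>{0, 1, 2}\<close>, and its hull has 2-dimension \<open>\<Sum> d(e) min (g e) (2 - g (\<sigma> e))\<close>. Averaging over all \<open>g\<close>,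
  \<open>e\<close> contributes \<open>d(e)/3\<close> if \<open>\<sigma> e = e\<close> and \<open>5 d(e)/9\<close> otherwise. The degrees \<open>d(e)\<close> add up to \<open>2n\<close>.
  Finally \<open>\<sigma> e = e\<close> iff \<open>xe\<close> and its inverse are conjugate under Frobenius, i.e. iff the order of \<open>xe\<close>
  divides some \<open>2\<^sup>i + 1\<close>, and the degrees \<open>d(e)\<close> with \<open>xe\<close> of order \<open>j\<close> add up to \<open>2 \<phi>(j)\<close>, by
  counting the fixed points of \<open>x\<^sup>j\<close> on \<open>A\<close>.
\<close>

hide_const (open) up_ring.monom up_ring.coeff

section \<open>Products of Galois rings of characteristic 4\<close>

text \<open>The nonempty fibres of \<open>h\<close> are translates of its kernel.\<close>

lemma card_additive_image:
  fixes h :: "'a::ab_group_add \<Rightarrow> 'b::ab_group_add"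
  assumes "finite A" and diff: "\<And>a b. a \<in> A \<Longrightarrow> b \<in> A \<Longrightarrow> a + b \<in> A \<and> a - b \<in> A"
    and h: "\<And>a b. a \<in> A \<Longrightarrow> b \<in> A \<Longrightarrow> h (a - b) = h a - h b \<and> h (a + b) = h a + h b"
  shows "card A = card (h ` A) * card {a \<in> A. h a = 0}"
proof -
  have "card {a \<in> A. h a = y} = card {a \<in> A. h a = 0}" if "y \<in> h ` A" for y
  proof -
    from that obtain z where z: "z \<in> A" "y = h z" by auto
    show ?thesis
      by (rule bij_betw_same_card[of "\<lambda>a. a - z"],
          rule bij_betw_byWitness[of _ "\<lambda>a. a + z"]) (use z diff h in auto)
  qed
  moreover have "card A = (\<Sum>y\<in>h ` A. card {a \<in> A. h a = y})"
    using sum.group[OF \<open>finite A\<close> finite_imageI[OF \<open>finite A\<close>] subset_refl,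
      where h = "\<lambda>_. 1::nat" and g = h] by simp
  ultimately show ?thesis by simp
qed

definition ideals_below :: "'a::comm_ring_1 \<Rightarrow> 'a set set" where
  "ideals_below u = {I. 0 \<in> I \<and> (\<forall>a\<in>I. u * a = a) \<and> (\<forall>a\<in>I. \<forall>b\<in>I. a + b \<in> I) \<and> (\<forall>r. \<forall>a\<in>I. r * a \<in> I)}"

text \<open>The ring under study is the ideal generated by the idempotent \<open>u\<close>; its
  elements are the \<open>a\<close> with \<open>u * a = a\<close>. By \<open>ann_two\<close> and
  \<open>four_u\<close>, congruence modulo 2 can be written \<open>2 * a = 2 * b\<close>. By
  \<open>two_power_q\<close> every element is its own \<open>q\<close>-th power modulo 2, so the
  reduction modulo 2 is a product of finite fields.\<close>

locale galois_product =
  fixes u :: "'a::comm_ring_1" and q :: nat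
  assumes u_idem: "u * u = u"
    and finite_A: "finite {a. u * a = a}"
    and four_u: "4 * u = 0"
    and ann_two: "u * a = a \<Longrightarrow> 2 * a = 0 \<Longrightarrow> \<exists>b. a = 2 * b"
    and q_ge_2: "q \<ge> 2"
    and two_power_q: "u * a = a \<Longrightarrow> 2 * a ^ q = 2 * a"
begin

section \<open>Primitive idempotents\<close>

definition prims :: "'a set" where
  "prims = {e. u * e = e \<and> e * e = e \<and> e \<noteq> 0 \<and> (\<forall>f. f * f = f \<longrightarrow> f * e = 0 \<or> f * e = e)}"

lemma prims_finite: "finite prims"
  by (rule finite_subset[OF _ finite_A]) (auto simp: prims_def)

lemma primsD:
  assumes "e \<in> prims"
  shows "u * e = e" "e * e = e" "e \<noteq> 0"
  using assms by (auto simp: prims_def)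

lemma four_mult:
  assumes "u * a = a" shows "4 * a = 0"
  by (metis assms four_u mult.assoc mult_zero_left)

lemma ann_two':
  assumes "u * a = a" "2 * a = 0" obtains c where "u * c = c" "a = 2 * c"
proof -
  obtain b where b: "a = 2 * b" using ann_two assms by blast
  have "a = 2 * (u * b)" using b assms by (metis mult.left_commute)
  moreover have "u * (u * b) = u * b" by (simp add: u_idem mult.assoc[symmetric])
  ultimately show ?thesis using that by blast
qed

lemma two_torsion_mult:
  assumes "u * a = a" "2 * a = 0" "2 * b = 0" shows "a * b = 0"
proof -
  obtain c where "a = 2 * c" using assms ann_two' by blast
  then have "a * b = c * (2 * b)" by (simp add: mult_ac)
  with assms show ?thesis by simp
qed

text \<open>Write a = b + d with 2d = 0. In a^2 = b^2 + 2bd + d^2 the last two terms vanish, so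
  squaring lifts a congruence modulo 2 to an equality.\<close>

lemma square_eqI:
  assumes "u * a = a" "u * b = b" "2 * a = 2 * b" shows "a * a = b * b"
proof -
  have "(a - b) * (a - b) = 0"
    by (rule two_torsion_mult) (use assms in \<open>auto simp: algebra_simps\<close>)
  moreover have "a * a = b * b + b * (2 * (a - b)) + (a - b) * (a - b)"
    by (simp add: algebra_simps)
  moreover have "2 * (a - b) = 0" using assms by (simp add: algebra_simps)
  ultimately show ?thesis by simp
qed

lemma idem_eqI:
  assumes "u * a = a" "u * b = b" "2 * a = 2 * b" "a * a = a" "b * b = b" shows "a = b"
  using square_eqI[OF assms(1-3)] assms by simp

lemma two_prim_nonzero:
  assumes "e \<in> prims" shows "2 * e \<noteq> 0"
  using assms two_torsion_mult[of e e] by (auto simp: prims_def)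

text \<open>Up to multiples of 2, \<open>a\<^bsup>q-1\<^esup>\<close> is an idempotent generating the same ideal as \<open>a\<close>;
  squaring it yields an honest idempotent.\<close>

lemma prim_dichotomy:
  assumes e: "e \<in> prims"
  obtains "2 * (a * e) = 0" | b where "a * b * e = e"
proof -
  define a' where "a' = a * e"
  define b where "b = a' ^ (q - 1)"
  have a': "u * a' = a'" using primsD[OF e] by (simp add: a'_def mult.left_commute)
  have a'e: "a' * e = a'" using primsD[OF e] by (simp add: a'_def mult.assoc)
  obtain k where k: "q = Suc (Suc k)" using q_ge_2 by (metis add_2_eq_Suc le_Suc_ex)
  have b: "b = a' * a' ^ (q - 2)" unfolding b_def k by simp
  have ub: "u * b = b" unfolding b by (simp add: a' mult.assoc[symmetric])
  have aq: "a' ^ q = a' * b" unfolding b_def k by simp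
  have two_ab: "2 * (a' * b) = 2 * a'" using two_power_q[OF a'] by (simp add: aq)
  have "2 * (b * b) = 2 * (b * (a' * a' ^ (q - 2)))" using b by simp
  also have "\<dots> = 2 * (a' * b) * a' ^ (q - 2)" by (simp only: mult_ac)
  also have "\<dots> = 2 * b" unfolding two_ab using b by (simp add: mult.assoc)
  finally have two_bb: "2 * (b * b) = 2 * b" .
  define f where "f = b * b"
  have uf: "u * f = f" using ub by (simp add: f_def mult.assoc[symmetric])
  have ff: "f * f = f" using square_eqI[OF uf ub] two_bb by (simp add: f_def)
  from e ff consider "f * e = 0" | "f * e = e" by (auto simp: prims_def)
  then show ?thesis
  proof cases
    case 1
    have "2 * a' = 2 * (a' * b) * b" using two_ab by (simp add: mult_ac)
    also have "\<dots> = 2 * (a' * e * b) * b" by (simp only: a'e)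
    also have "\<dots> = 2 * (f * e) * a'" by (simp only: f_def mult_ac)
    finally have "2 * a' = 0" by (simp add: 1)
    then show ?thesis using that by (simp add: a'_def)
  next
    case 2
    \<comment> \<open>Since \<open>f\<close> contains the factor \<open>a'\<close>, the equation
      \<open>f * e = e\<close> already displays an inverse of \<open>a\<close> on the
      component.\<close>
    have "a * (e * (a' ^ (q - 2) * b)) * e = (a * e) * a' ^ (q - 2) * b * e"
      by (simp only: mult_ac)
    also have "\<dots> = f * e" by (simp add: f_def b[symmetric] a'_def[symmetric])
    finally have "a * (e * (a' ^ (q - 2) * b)) * e = f * e" .
    then show ?thesis using that 2 by metis
  qed
qed

lemma prims_orth:
  assumes "e \<in> prims" "f \<in> prims" "e \<noteq> f" shows "e * f = 0"
  using assms by (auto simp: prims_def) (metis mult.commute)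

text \<open>Induction on the size of the ideal generated by \<open>g\<close>: if \<open>g\<close> is
  not primitive, some \<open>f * g\<close> is a nonzero idempotent generating a strictly smaller
  ideal.\<close>

lemma ex_prim_below:
  assumes "u * g = g" "g * g = g" "g \<noteq> 0"
  shows "\<exists>e\<in>prims. e * g = e"
  using assms
proof (induction "card {k. u * k = k \<and> k * g = k}" arbitrary: g rule: less_induct)
  case less
  show ?case
  proof (cases "g \<in> prims")
    case True
    then show ?thesis using less by blast
  next
    case False
    then obtain f where f: "f * f = f" "f * g \<noteq> 0" "f * g \<noteq> g"
      using less.prems by (auto simp: prims_def)
    define h where "h = f * g"
    have h: "h * h = h" "u * h = h" "h \<noteq> 0" "h * g = h"
      using f less.prems unfolding h_def by (simp_all add: mult_ac) (metis mult.assoc mult.commute)+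
    have sub: "{k. u * k = k \<and> k * h = k} \<subset> {k. u * k = k \<and> k * g = k}"
    proof (intro psubsetI subsetI)
      fix k assume "k \<in> {k. u * k = k \<and> k * h = k}"
      then show "k \<in> {k. u * k = k \<and> k * g = k}" using h(4) by (auto) (metis mult.assoc)
    next
      have "g * h \<noteq> g" using h f by (simp add: h_def mult.commute)
      then show "{k. u * k = k \<and> k * h = k} \<noteq> {k. u * k = k \<and> k * g = k}"
        using less.prems by blast
    qed
    have "card {k. u * k = k \<and> k * h = k} < card {k. u * k = k \<and> k * g = k}"
      by (rule psubset_card_mono[OF _ sub]) (rule finite_subset[OF _ finite_A], auto)
    from less.hyps[OF this h(2,1,3)] obtain e where "e \<in> prims" "e * h = e" by blast
    then show ?thesis using h(4) by (metis mult.assoc)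
  qed
qed

lemma prim_mult_sum:
  assumes "e \<in> prims" shows "e * \<Sum>prims = e"
proof -
  have "e * \<Sum>prims = (\<Sum>f\<in>prims. if f = e then e else 0)"
    unfolding sum_distrib_left
    by (rule sum.cong) (use assms prims_orth primsD in auto)
  then show ?thesis using assms prims_finite by simp
qed

lemma sum_prims: "\<Sum>prims = u"
proof (rule ccontr)
  assume ne: "\<Sum>prims \<noteq> u"
  \<comment> \<open>The complement would be a nonzero idempotent orthogonal to all primitive ones,
    yet some primitive idempotent lies below it.\<close>
  define g where "g = u - \<Sum>prims"
  have us: "u * \<Sum>prims = \<Sum>prims" by (simp add: sum_distrib_left primsD)
  have ss: "\<Sum>prims * \<Sum>prims = \<Sum>prims" by (simp add: sum_distrib_right prim_mult_sum)
  have "u * g = g" "g * g = g" "g \<noteq> 0"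
    using us ss ne u_idem by (simp_all add: g_def algebra_simps)
  then obtain e where e: "e \<in> prims" "e * g = e" using ex_prim_below by blast
  then have "e * g = 0" using primsD[OF e(1)] by (simp add: g_def algebra_simps prim_mult_sum)
  with e primsD show False by auto
qed

lemma decompose:
  assumes "u * a = a" shows "a = (\<Sum>e\<in>prims. a * e)"
proof -
  have "a * \<Sum>prims = a" using assms by (simp add: sum_prims mult.commute)
  then show ?thesis by (simp add: sum_distrib_left)
qed

lemma decompose_mult:
  assumes "e \<in> prims" "\<And>f. f \<in> prims \<Longrightarrow> h f * f = h f"
  shows "(\<Sum>f\<in>prims. h f) * e = h e"
proof -
  have "(\<Sum>f\<in>prims. h f) * e = (\<Sum>f\<in>prims. if f = e then h e else 0)"
    unfolding sum_distrib_right
  proof (rule sum.cong)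
    fix f assume f: "f \<in> prims"
    have "h f * e = h f * (f * e)" using assms(2)[OF f] by (metis mult.assoc)
    then show "h f * e = (if f = e then h e else 0)"
      using assms f prims_orth by auto
  qed simp
  then show ?thesis using assms prims_finite by simp
qed

section \<open>Classification of the ideals\<close>

lemma ann_pow_two:
  assumes "k \<le> 2" "u * a = a" "2 ^ k * a = 0"
  obtains c where "u * c = c" "a = 2 ^ (2 - k) * c"
proof -
  from assms(1) consider "k = 0" | "k = 1" | "k = 2" by linarith
  then show ?thesis
  proof cases
    case 1 with assms that[of 0] show ?thesis by simp
  next
    case 2 with assms ann_two'[of a] that show ?thesis by auto
  next
    case 3 with assms that[of a] show ?thesis by simp
  qed
qed

lemma pow_two_prim_eq_0_iff:
  assumes "e \<in> prims" "k \<le> 2" shows "2 ^ k * e = 0 \<longleftrightarrow> k = 2"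
proof -
  from assms(2) consider "k = 0" | "k = 1" | "k = 2" by linarith
  then show ?thesis
    by cases (use primsD[OF assms(1)] two_prim_nonzero[OF assms(1)] four_mult[of e] in auto)
qed

text \<open>On \<open>Ae\<close> this is the annihilator of \<open>2 ^ g e\<close>, that is 2^(2 - g
  e) Ae; the values 0, 1, 2 stand for 0, 2Ae, Ae. Using annihilators turns membership into
  equations.\<close>

definition ann_ideal :: "('a \<Rightarrow> nat) \<Rightarrow> 'a set" where
  "ann_ideal g = {a. u * a = a \<and> (\<forall>e\<in>prims. 2 ^ g e * (a * e) = 0)}"

lemma ann_ideal_in: "ann_ideal g \<in> ideals_below u"
  unfolding ann_ideal_def ideals_below_def
  by (auto simp: algebra_simps)

text \<open>These test elements recover \<open>g\<close> from the ideal, which gives injectivity,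
  and they generate its components.\<close>

lemma pow_two_prim_in_ann_ideal_iff:
  assumes "e \<in> prims" "g e \<le> 2" "k \<le> 2"
  shows "2 ^ (2 - k) * e \<in> ann_ideal g \<longleftrightarrow> k \<le> g e"
proof -
  have "2 ^ g f * (2 ^ (2 - k) * e * f) = (if f = e then 2 ^ (g e + (2 - k)) * e else 0)"
    if "f \<in> prims" for f
  proof -
    have "2 ^ g f * (2 ^ (2 - k) * e * f) = 2 ^ (g f + (2 - k)) * (e * f)"
      by (simp only: mult_ac power_add)
    then show ?thesis using that assms prims_orth[of e f] primsD[of e] by auto
  qed
  moreover have "u * (2 ^ (2 - k) * e) = 2 ^ (2 - k) * e"
    by (simp only: mult.left_commute[of u] primsD(1)[OF assms(1)])
  ultimately have "2 ^ (2 - k) * e \<in> ann_ideal g \<longleftrightarrow> 2 ^ (g e + (2 - k)) * e = 0"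
    using assms(1) unfolding ann_ideal_def by auto
  also have "\<dots> \<longleftrightarrow> k \<le> g e"
  proof (cases "k \<le> g e")
    case True
    then have "g e + (2 - k) = (g e - k) + 2" using assms by linarith
    then have "2 ^ (g e + (2 - k)) * e = 2 ^ (g e - k) * (2 ^ 2 * e)"
      by (simp only: power_add mult.assoc)
    also have "\<dots> = 0" using four_mult[of e] primsD[OF assms(1)] by simp
    finally show ?thesis using True by simp
  next
    case False
    then show ?thesis using assms pow_two_prim_eq_0_iff[of e "g e + (2 - k)"] by auto
  qed
  finally show ?thesis .
qed

lemma ann_ideal_inj: "inj_on ann_ideal (prims \<rightarrow>\<^sub>E {..2})"
proof (rule inj_onI)
  fix g h assume gh: "g \<in> prims \<rightarrow>\<^sub>E {..2}" "h \<in> prims \<rightarrow>\<^sub>E {..2}" "ann_ideal g = ann_ideal h"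
  have "g e = h e" if "e \<in> prims" for e
  proof -
    have "g e \<le> 2" "h e \<le> 2" using gh that by (auto simp: PiE_iff)
    then show ?thesis
      using pow_two_prim_in_ann_ideal_iff[OF that, of g] pow_two_prim_in_ann_ideal_iff[OF that, of h]
      by (metis gh(3) le_antisym order_refl)
  qed
  then show "g = h" using gh by (metis PiE_ext)
qed

text \<open>By \<open>prim_dichotomy\<close> an element of \<open>Ae\<close> is either invertible
  there or a multiple of 2, so the \<open>e\<close>-part of \<open>I\<close> is determined by which
  of \<open>e\<close> and \<open>2 * e\<close> lie in \<open>I\<close>.\<close>

lemma ideal_eq_ann_ideal:
  assumes I: "I \<in> ideals_below u"
  shows "\<exists>g \<in> prims \<rightarrow>\<^sub>E {..2}. I = ann_ideal g"
proof
  define g where "g = (\<lambda>e\<in>prims. if e \<in> I then 2 else if 2 * e \<in> I then 1 else 0::nat)"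
  show "g \<in> prims \<rightarrow>\<^sub>E {..2}" by (auto simp: g_def)
  have mult: "r * a \<in> I" if "a \<in> I" for r a using I that by (auto simp: ideals_below_def)
  have sum: "(\<Sum>x\<in>X. h x) \<in> I" if "\<And>x. x \<in> X \<Longrightarrow> h x \<in> I" for h and X :: "'a set"
    using that by (induction X rule: infinite_finite_induct) (use I in \<open>auto simp: ideals_below_def\<close>)
  show "I = ann_ideal g"
  proof (intro Set.set_eqI iffI)
    fix a assume a: "a \<in> I"
    then have ua: "u * a = a" using I by (auto simp: ideals_below_def)
    have "2 ^ g e * (a * e) = 0" if e: "e \<in> prims" for e
    proof (cases "e \<in> I")
      case True
      then show ?thesis using e four_mult[of "a * e"] ua by (simp add: g_def mult.assoc[symmetric])
    next
      case False
      have t: "2 * (a * e) = 0"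
      proof (rule prim_dichotomy[OF e, of a])
        fix b assume "a * b * e = e"
        then have "e \<in> I" using mult[OF a, of "b * e"] by (simp add: mult_ac)
        then show ?thesis using False by simp
      qed simp
      show ?thesis
      proof (cases "2 * e \<in> I")
        case True
        then show ?thesis using False e t by (simp add: g_def)
      next
        case F2: False
        have "u * (a * e) = a * e" using ua by (simp add: mult.assoc[symmetric])
        then obtain c where c: "a * e = 2 * c" using t ann_two' by metis
        have "2 * (c * e) = 0"
        proof (rule prim_dichotomy[OF e, of c])
          \<comment> \<open>If \<open>c\<close> were invertible on the component,
            \<open>2 * e\<close> would be a multiple of \<open>2 * c\<close>, hence of
            \<open>a\<close>.\<close>
          fix b assume b: "c * b * e = e"
          have "2 * (c * b * e) = b * (2 * c) * e" by (simp only: mult_ac)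
          also have "\<dots> = b * (a * e) * e" by (simp only: c)
          also have "\<dots> = b * a * (e * e)" by (simp only: mult_ac)
          also have "\<dots> = b * e * a" by (simp only: primsD(2)[OF e] mult_ac)
          finally have "2 * (c * b * e) = b * e * a" .
          then show ?thesis using F2 mult[OF a, of "b * e"] by (simp add: b)
        qed simp
        moreover have "a * e = 2 * (c * e)"
          using c primsD(2)[OF e] by (metis mult.assoc)
        ultimately show ?thesis by simp
      qed
    qed
    then show "a \<in> ann_ideal g" using ua by (simp add: ann_ideal_def)
  next
    fix a assume a: "a \<in> ann_ideal g"
    then have ua: "u * a = a" by (auto simp: ann_ideal_def)
    have "a * e \<in> I" if e: "e \<in> prims" for e
    proof -
      have "g e \<le> 2" "u * (a * e) = a * e" "2 ^ g e * (a * e) = 0"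
        using e a ua by (auto simp: g_def ann_ideal_def mult.assoc[symmetric])
      then obtain c where c: "a * e = 2 ^ (2 - g e) * c" using ann_pow_two by metis
      then have "a * e = c * (2 ^ (2 - g e) * e)"
        using primsD(2)[OF e] by (metis mult.assoc mult.commute)
      \<comment> \<open>The three cases follow the definition of \<open>g\<close>; for
        \<open>g e = 0\<close> the element is \<open>4 * e = 0\<close>.\<close>
      moreover have "2 ^ (2 - g e) * e \<in> I"
        using e mult[of 0 0] I by (auto simp: g_def four_mult primsD ideals_below_def)
      ultimately show ?thesis using mult by simp
    qed
    then show "a \<in> I" using decompose[OF ua] sum[of prims "\<lambda>e. a * e"] by simp
  qed
qed

lemma bij_ann_ideal: "bij_betw ann_ideal (prims \<rightarrow>\<^sub>E {..2}) (ideals_below u)"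
  unfolding bij_betw_def using ann_ideal_inj ann_ideal_in ideal_eq_ann_ideal by blast

section \<open>Sizes of the ideals\<close>

text \<open>This is d(e): the 2-torsion of \<open>Ae\<close> is 2Ae, which is as large as the
  residue field of \<open>Ae\<close>.\<close>

definition prim_dim :: "'a \<Rightarrow> real" where
  "prim_dim e = log 2 (card {a. a * e = a \<and> 2 * a = 0})"

lemma finite_prim_part: 
  assumes "e \<in> prims" shows "finite {a. a * e = a}"
proof (rule finite_subset[OF _ finite_A], safe)
  fix a assume "a * e = a"
  then show "u * a = a" using primsD(1)[OF assms] by (metis mult.left_commute)
qed

lemma card_prim_part:
  assumes e: "e \<in> prims" and "k \<le> 2"
  shows "card {a. a * e = a \<and> 2 ^ k * a = 0} = card {a. a * e = a \<and> 2 * a = 0} ^ k"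
proof -
  from assms(2) consider "k = 0" | "k = 1" | "k = 2" by linarith
  then show ?thesis
  proof cases
    case 1
    have "{a. a * e = a \<and> a = 0} = {0}" by auto
    with 1 show ?thesis by simp
  next
    case 2
    then show ?thesis by simp
  next
    case 3
    have uA: "u * a = a" if "a * e = a" for a
      using that primsD(1)[OF e] by (metis mult.left_commute)
    \<comment> \<open>On \<open>Ae\<close>, multiplication by 2 has the 2-torsion both as kernel and
      as image, so the size of \<open>Ae\<close> is a square.\<close>
    have "card {a. a * e = a} = card ((*) 2 ` {a. a * e = a}) * card {a \<in> {a. a * e = a}. 2 * a = 0}"
      by (rule card_additive_image) (use finite_prim_part[OF e] in \<open>auto simp: algebra_simps\<close>)
    also have "(*) 2 ` {a. a * e = a} = {a. a * e = a \<and> 2 * a = 0}"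
    proof (intro Set.set_eqI iffI)
      fix a assume "a \<in> {a. a * e = a \<and> 2 * a = 0}"
      then have a: "a * e = a" "2 * a = 0" by auto
      then obtain c where "a = 2 * c" using ann_two'[OF uA] by blast
      then have "a = 2 * (c * e)" using a by (metis mult.assoc)
      moreover have "c * e * e = c * e" by (simp add: mult.assoc primsD[OF e])
      ultimately show "a \<in> (*) 2 ` {a. a * e = a}" by blast
    next
      fix a assume "a \<in> (*) 2 ` {a. a * e = a}"
      then show "a \<in> {a. a * e = a \<and> 2 * a = 0}"
        using uA by (auto simp: mult.assoc four_mult)
    qed
    finally have "card {a. a * e = a} = card {a. a * e = a \<and> 2 * a = 0} ^ 2"
      by (simp add: power2_eq_square)
    moreover have "{a. a * e = a \<and> 4 * a = 0} = {a. a * e = a}"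
      using uA four_mult by auto
    ultimately show ?thesis using 3 by simp
  qed
qed

lemma card_prim_part_pos:
  assumes "e \<in> prims" shows "card {a. a * e = a \<and> 2 * a = 0} > 0"
proof -
  have "0 \<in> {a. a * e = a \<and> 2 * a = 0}" by simp
  moreover have "finite {a. a * e = a \<and> 2 * a = 0}"
    using finite_prim_part[OF assms] by simp
  ultimately show ?thesis by (metis card_gt_0_iff empty_iff)
qed

lemma log_card_ann_ideal:
  assumes "\<And>e. e \<in> prims \<Longrightarrow> g e \<le> 2"
  shows "log 2 (card (ann_ideal g)) = (\<Sum>e\<in>prims. prim_dim e * g e)"
proof -
  let ?F = "\<Pi>\<^sub>E e\<in>prims. {a. a * e = a \<and> 2 ^ g e * a = 0}"
  \<comment> \<open>Chinese remainder decomposition: project onto the components; the inverse adds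
    them up.\<close>
  have "bij_betw (\<lambda>a. \<lambda>e\<in>prims. a * e) (ann_ideal g) ?F"
  proof (rule bij_betw_byWitness[of _ "\<lambda>h. \<Sum>e\<in>prims. h e"])
    show "\<forall>a\<in>ann_ideal g. (\<Sum>e\<in>prims. (\<lambda>e\<in>prims. a * e) e) = a"
      using decompose by (auto simp: ann_ideal_def)
    show "\<forall>h\<in>?F. (\<lambda>e\<in>prims. (\<Sum>e\<in>prims. h e) * e) = h"
    proof
      fix h assume h: "h \<in> ?F"
      show "(\<lambda>e\<in>prims. (\<Sum>e\<in>prims. h e) * e) = h"
      proof
        fix e
        show "(\<lambda>e\<in>prims. (\<Sum>e\<in>prims. h e) * e) e = h e"
          using h decompose_mult[of e h] by (cases "e \<in> prims") (auto simp: PiE_iff extensional_def)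
      qed
    qed
    show "(\<lambda>a. \<lambda>e\<in>prims. a * e) ` ann_ideal g \<subseteq> ?F"
      using primsD by (auto simp: ann_ideal_def mult.assoc)
    show "(\<lambda>h. \<Sum>e\<in>prims. h e) ` ?F \<subseteq> ann_ideal g"
    proof safe
      fix h assume h: "h \<in> ?F"
      then have he: "h e * e = h e" "2 ^ g e * h e = 0" if "e \<in> prims" for e
        using that by (auto simp: PiE_iff)
      have "u * h e = h e" if "e \<in> prims" for e
        using he(1) primsD(1) that by (metis mult.left_commute)
      then have "u * (\<Sum>e\<in>prims. h e) = (\<Sum>e\<in>prims. h e)"
        by (simp add: sum_distrib_left)
      then show "(\<Sum>e\<in>prims. h e) \<in> ann_ideal g"
        using decompose_mult[of _ h] he by (auto simp: ann_ideal_def)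
    qed
  qed
  then have "card (ann_ideal g) = (\<Prod>e\<in>prims. card {a. a * e = a \<and> 2 * a = 0} ^ g e)"
    using prims_finite assms by (simp add: bij_betw_same_card card_PiE card_prim_part)
  then have "log 2 (card (ann_ideal g)) =
      (\<Sum>e\<in>prims. log 2 (card {a. a * e = a \<and> 2 * a = 0} ^ g e))"
    using card_prim_part_pos prims_finite by (simp add: log_def ln_prod sum_divide_distrib)
  then show ?thesis
    using card_prim_part_pos by (simp add: prim_dim_def log_nat_power mult.commute)
qed

end

section \<open>Averages over functions into {0, 1, 2}\<close>

text \<open>The factor 3 on the left avoids the exponent \<open>card P - 1\<close>.\<close>

lemma card_PiE_one_prescribed:
  assumes "finite P" "e \<in> P" "X \<subseteq> {..2::nat}"
  shows "3 * card {g \<in> P \<rightarrow>\<^sub>E {..2::nat}. g e \<in> X} = card X * 3 ^ card P"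
proof -
  define T where "T = (\<lambda>i. if i = e then X else {..2::nat})"
  obtain Q where Q: "P = insert e Q" "e \<notin> Q" using assms by (meson Set.set_insert)
  have "{g \<in> P \<rightarrow>\<^sub>E {..2::nat}. g e \<in> X} = (\<Pi>\<^sub>E i\<in>P. T i)"
  proof -
    have "(\<forall>i\<in>P. g i \<in> T i) \<longleftrightarrow> (\<forall>i\<in>P. g i \<in> {..2}) \<and> g e \<in> X" for g
      using assms unfolding T_def by (metis subsetD)
    then show ?thesis by (intro Set.set_eqI) (simp add: PiE_iff, blast)
  qed
  moreover have "(\<Prod>i\<in>Q. card (T i)) = 3 ^ card Q"
  proof -
    have "(\<Prod>i\<in>Q. card (T i)) = (\<Prod>i\<in>Q. 3)"
      by (rule prod.cong) (use Q in \<open>auto simp: T_def\<close>)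
    then show ?thesis by simp
  qed
  ultimately show ?thesis using assms Q by (simp add: card_PiE T_def)
qed

lemma card_PiE_two_prescribed:
  assumes "finite P" "e \<in> P" "f \<in> P" "e \<noteq> f" "X \<subseteq> {..2::nat}" "Y \<subseteq> {..2::nat}"
  shows "9 * card {g \<in> P \<rightarrow>\<^sub>E {..2::nat}. g e \<in> X \<and> g f \<in> Y} = card X * card Y * 3 ^ card P"
proof -
  define T where "T = (\<lambda>i. if i = e then X else if i = f then Y else {..2::nat})"
  obtain Q where Q: "P = insert e (insert f Q)" "e \<notin> Q" "f \<notin> Q"
    using assms by (metis Set.set_insert insert_iff)
  have "{g \<in> P \<rightarrow>\<^sub>E {..2::nat}. g e \<in> X \<and> g f \<in> Y} = (\<Pi>\<^sub>E i\<in>P. T i)"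
  proof -
    have "(\<forall>i\<in>P. g i \<in> T i) \<longleftrightarrow> (\<forall>i\<in>P. g i \<in> {..2}) \<and> g e \<in> X \<and> g f \<in> Y" for g
      using assms unfolding T_def by (metis subsetD)
    then show ?thesis by (intro Set.set_eqI) (simp add: PiE_iff, blast)
  qed
  moreover have "(\<Prod>i\<in>Q. card (T i)) = 3 ^ card Q"
  proof -
    have "(\<Prod>i\<in>Q. card (T i)) = (\<Prod>i\<in>Q. 3)"
      by (rule prod.cong) (use Q in \<open>auto simp: T_def\<close>)
    then show ?thesis by simp
  qed
  ultimately show ?thesis using assms Q by (simp add: card_PiE T_def)
qed

text \<open>Only \<open>g e\<close> and \<open>g f\<close> matter. If \<open>e = f\<close>, just the
  value 1 contributes, one choice in three; otherwise the nine pairs of values contribute 5 in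
  total.\<close>

lemma sum_min_PiE:
  assumes "finite P" "e \<in> P" "f \<in> P"
  shows "(\<Sum>g\<in>P \<rightarrow>\<^sub>E {..2::nat}. real (min (g e) (2 - g f))) = (if e = f then 1 / 3 else 5 / 9) * 3 ^ card P"
proof -
  let ?N = "\<lambda>X Y. {g \<in> P \<rightarrow>\<^sub>E {..2::nat}. g e \<in> X \<and> g f \<in> Y}"
  have fin: "finite (P \<rightarrow>\<^sub>E {..2::nat})" using assms by (simp add: finite_PiE)
  \<comment> \<open>The minimum is counted by levels, at least 1 and at least 2. For
    \<open>e\<close> different from \<open>f\<close> these levels hold for 2 * 2 and 1 * 1 pairs of
    values.\<close>
  have min: "min (g e) (2 - g f) = of_bool (g e \<in> {1..2} \<and> g f \<in> {0..1}) + of_bool (g e \<in> {2} \<and> g f \<in> {0})"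
    if "g \<in> P \<rightarrow>\<^sub>E {..2::nat}" for g
  proof -
    have "g e \<le> 2" "g f \<le> 2" using that assms by (auto simp: PiE_iff)
    then show ?thesis by (auto simp: min_def)
  qed
  have "(\<Sum>g\<in>P \<rightarrow>\<^sub>E {..2::nat}. min (g e) (2 - g f)) = card (?N {1..2} {0..1}) + card (?N {2} {0})"
  proof -
    have "(\<Sum>g\<in>P \<rightarrow>\<^sub>E {..2::nat}. min (g e) (2 - g f)) =
        (\<Sum>g\<in>P \<rightarrow>\<^sub>E {..2::nat}. of_bool (g e \<in> {1..2} \<and> g f \<in> {0..1}) + of_bool (g e \<in> {2} \<and> g f \<in> {0}))"
      by (rule sum.cong[OF refl min])
    moreover have "(\<Sum>g\<in>P \<rightarrow>\<^sub>E {..2::nat}. of_bool (Q g)) = card {g \<in> P \<rightarrow>\<^sub>E {..2::nat}. Q g}" for Q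
      using fin by (simp add: Int_def)
    ultimately show ?thesis by (simp only: sum.distrib)
  qed
  moreover have "9 * (card (?N {1..2} {0..1}) + card (?N {2} {0})) = (if e = f then 3 else 5) * 3 ^ card P"
  proof (cases "e = f")
    case True
    then have "?N {1..2} {0..1} = {g \<in> P \<rightarrow>\<^sub>E {..2::nat}. g e \<in> {1}}" "?N {2} {0} = {}" by auto
    then show ?thesis using card_PiE_one_prescribed[OF assms(1,2), of "{1}"] True
      by (simp only: card.empty) simp
  next
    case False
    then show ?thesis
      using card_PiE_two_prescribed[OF assms False, of "{1..2}" "{0..1}"]
        card_PiE_two_prescribed[OF assms False, of "{2}" "{0}"] by (simp add: algebra_simps)
  qed
  ultimately have "9 * (\<Sum>g\<in>P \<rightarrow>\<^sub>E {..2::nat}. min (g e) (2 - g f)) = (if e = f then 3 else 5) * 3 ^ card P"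
    by simp
  then have "real (9 * (\<Sum>g\<in>P \<rightarrow>\<^sub>E {..2::nat}. min (g e) (2 - g f))) = real ((if e = f then 3 else 5) * 3 ^ card P)"
    by (rule arg_cong)
  then show ?thesis by (cases "e = f") (simp_all add: of_nat_sum)
qed

section \<open>Duality and hulls under an involution\<close>

text \<open>The law \<open>\<sigma>_invol\<close> is asked for below \<open>u\<close> only: x
  \<mapsto> x^(n-1) is an involution on the factor of length n, but need not be one on the other
  factors.\<close>

locale galois_product_involution = galois_product +
  fixes \<sigma> :: "'a \<Rightarrow> 'a"
  assumes \<sigma>_add: "\<sigma> (a + b) = \<sigma> a + \<sigma> b"
    and \<sigma>_mult: "\<sigma> (a * b) = \<sigma> a * \<sigma> b"
    and \<sigma>_u: "\<sigma> u = u"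
    and \<sigma>_invol: "u * a = a \<Longrightarrow> \<sigma> (\<sigma> a) = a"
begin

definition dual_ideal :: "'a set \<Rightarrow> 'a set" where
  "dual_ideal I = {a. u * a = a \<and> (\<forall>b\<in>I. a * \<sigma> b = 0)}"

lemma \<sigma>_0: "\<sigma> 0 = 0"
  using \<sigma>_add[of 0 0] by simp

lemma \<sigma>_unit: "u * a = a \<Longrightarrow> u * \<sigma> a = \<sigma> a"
  by (metis \<sigma>_mult \<sigma>_u)

lemma \<sigma>_two: "\<sigma> (2 ^ k * a) = 2 ^ k * \<sigma> a"
proof -
  have "\<sigma> (2 * a) = 2 * \<sigma> a" for a by (simp only: mult_2 \<sigma>_add)
  then show ?thesis by (induction k) (simp_all add: mult.assoc)
qed

lemma \<sigma>_prims:
  assumes "e \<in> prims" shows "\<sigma> e \<in> prims"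
proof -
  note e = primsD[OF assms]
  have "f * \<sigma> e = 0 \<or> f * \<sigma> e = \<sigma> e" if "f * f = f" for f
  proof -
    have ue: "u * (f * \<sigma> e) = f * \<sigma> e"
      using \<sigma>_unit[OF e(1)] by (simp add: mult.left_commute)
    have "\<sigma> f * \<sigma> f = \<sigma> f" using that by (metis \<sigma>_mult)
    then have "\<sigma> f * e = 0 \<or> \<sigma> f * e = e" using assms by (auto simp: prims_def)
    then have "\<sigma> (f * \<sigma> e) = 0 \<or> \<sigma> (f * \<sigma> e) = e" by (simp add: \<sigma>_mult \<sigma>_invol e)
    then show ?thesis using \<sigma>_invol[OF ue] \<sigma>_0 by metis
  qed
  moreover have "\<sigma> e \<noteq> 0" using \<sigma>_invol[OF e(1)] \<sigma>_0 e(3) by metis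
  moreover have "\<sigma> e * \<sigma> e = \<sigma> e" using e(2) by (metis \<sigma>_mult)
  ultimately show ?thesis using \<sigma>_unit[OF e(1)] by (auto simp: prims_def)
qed

text \<open>Within one component the ideals annihilated by 2^k and by 2^(2-k) annihilate each other,
  and \<sigma> carries the component of \<open>\<sigma> e\<close> to that of
  \<open>e\<close>.\<close>

lemma dual_ann_ideal:
  assumes g: "\<And>e. e \<in> prims \<Longrightarrow> g e \<le> 2"
  shows "dual_ideal (ann_ideal g) = ann_ideal (\<lambda>e. 2 - g (\<sigma> e))"
proof (intro Set.set_eqI iffI)
  fix a assume a: "a \<in> dual_ideal (ann_ideal g)"
  have "2 ^ (2 - g (\<sigma> e)) * (a * e) = 0" if e: "e \<in> prims" for e
  proof -
    \<comment> \<open>The generator of the \<open>\<sigma> e\<close>-part suffices as a test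
      element; \<sigma> sends it to the required multiple of \<open>e\<close>.\<close>
    have "2 ^ (2 - g (\<sigma> e)) * \<sigma> e \<in> ann_ideal g"
      using pow_two_prim_in_ann_ideal_iff[of "\<sigma> e" g "g (\<sigma> e)"] g \<sigma>_prims[OF e] by simp
    then have "a * \<sigma> (2 ^ (2 - g (\<sigma> e)) * \<sigma> e) = 0" using a by (auto simp: dual_ideal_def)
    then show ?thesis by (simp add: \<sigma>_two \<sigma>_invol primsD[OF e] mult.left_commute)
  qed
  then show "a \<in> ann_ideal (\<lambda>e. 2 - g (\<sigma> e))" using a by (auto simp: dual_ideal_def ann_ideal_def)
next
  fix a assume "a \<in> ann_ideal (\<lambda>e. 2 - g (\<sigma> e))"
  then have "u * a = a" and a: "\<And>e. e \<in> prims \<Longrightarrow> 2 ^ (2 - g (\<sigma> e)) * (a * e) = 0"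
    by (auto simp: ann_ideal_def)
  moreover have "a * \<sigma> b = 0" if b: "b \<in> ann_ideal g" for b
  proof -
    have "a * \<sigma> b * e = 0" if e: "e \<in> prims" for e
    proof -
      have "u * (a * e) = a * e" using \<open>u * a = a\<close> by (simp add: mult.assoc[symmetric])
      \<comment> \<open>On the component of \<open>e\<close>, \<open>a\<close> supplies the power of
        2 that kills \<open>\<sigma> b\<close>.\<close>
      then obtain c where c: "a * e = 2 ^ (2 - (2 - g (\<sigma> e))) * c"
        using ann_pow_two[of "2 - g (\<sigma> e)" "a * e"] a[OF e] by auto
      have "a * \<sigma> b * e = a * e * (\<sigma> b * e)" using primsD(2)[OF e] by (metis mult.assoc mult.commute)
      also have "\<dots> = c * (2 ^ g (\<sigma> e) * (\<sigma> b * e))"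
        using g[OF \<sigma>_prims[OF e]] by (simp add: c mult_ac)
      also have "2 ^ g (\<sigma> e) * (\<sigma> b * e) = \<sigma> (2 ^ g (\<sigma> e) * (b * \<sigma> e))"
        by (simp only: \<sigma>_two \<sigma>_mult[of b] \<sigma>_invol[OF primsD(1)[OF e]])
      also have "2 ^ g (\<sigma> e) * (b * \<sigma> e) = 0" using b \<sigma>_prims[OF e] by (simp add: ann_ideal_def)
      finally show ?thesis by (simp add: \<sigma>_0)
    qed
    moreover have "u * (a * \<sigma> b) = a * \<sigma> b" using \<open>u * a = a\<close> by (simp add: mult.assoc[symmetric])
    ultimately show ?thesis using decompose[of "a * \<sigma> b"] by simp
  qed
  ultimately show "a \<in> dual_ideal (ann_ideal g)" by (auto simp: dual_ideal_def)
qed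

lemma ann_ideal_Int:
  "ann_ideal g \<inter> ann_ideal h = ann_ideal (\<lambda>e. min (g e) (h e))"
proof -
  have "2 ^ min k l * a = 0 \<longleftrightarrow> 2 ^ k * a = 0 \<and> 2 ^ l * a = 0" for k l :: nat and a :: 'a
  proof -
    have "2 ^ m * a = 0" if "2 ^ k * a = 0" "k \<le> m" for k m :: nat
    proof -
      have "2 ^ m * a = 2 ^ (m - k) * (2 ^ k * a)"
        using that(2) by (simp add: power_add[symmetric] mult.assoc[symmetric])
      then show ?thesis using that(1) by simp
    qed
    then show ?thesis by (cases k l rule: le_cases) (auto simp: min_def)
  qed
  then show ?thesis by (auto simp: ann_ideal_def)
qed

lemma sum_log_card_hull:
  "(\<Sum>I\<in>ideals_below u. log 2 (card (I \<inter> dual_ideal I))) / card (ideals_below u) =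
    (\<Sum>e\<in>prims. prim_dim e * (if \<sigma> e = e then 1 / 3 else 5 / 9))"
proof -
  have le: "g e \<le> 2" if "g \<in> prims \<rightarrow>\<^sub>E {..2}" "e \<in> prims" for e and g :: "'a \<Rightarrow> nat"
    using that by (auto simp: PiE_iff)
  have card: "card (ideals_below u) = 3 ^ card prims"
    using bij_betw_same_card[OF bij_ann_ideal] prims_finite by (simp add: card_PiE)
  have "(\<Sum>I\<in>ideals_below u. log 2 (card (I \<inter> dual_ideal I))) =
     (\<Sum>g\<in>prims \<rightarrow>\<^sub>E {..2}. log 2 (card (ann_ideal g \<inter> dual_ideal (ann_ideal g))))"
    by (rule sum.reindex_bij_betw[OF bij_ann_ideal, symmetric])
  also have "\<dots> = (\<Sum>g\<in>prims \<rightarrow>\<^sub>E {..2}. \<Sum>e\<in>prims. prim_dim e * real (min (g e) (2 - g (\<sigma> e))))"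
  proof (rule sum.cong[OF refl])
    fix g :: "'a \<Rightarrow> nat" assume g: "g \<in> prims \<rightarrow>\<^sub>E {..2}"
    show "log 2 (card (ann_ideal g \<inter> dual_ideal (ann_ideal g))) =
        (\<Sum>e\<in>prims. prim_dim e * real (min (g e) (2 - g (\<sigma> e))))"
    proof -
      have "dual_ideal (ann_ideal g) = ann_ideal (\<lambda>e. 2 - g (\<sigma> e))"
        by (rule dual_ann_ideal) (rule le[OF g])
      then show ?thesis
        using log_card_ann_ideal[of "\<lambda>e. min (g e) (2 - g (\<sigma> e))"]
        by (simp add: ann_ideal_Int min_le_iff_disj)
    qed
  qed
  \<comment> \<open>Exchanging the sums leaves, for each \<open>e\<close>, the count of
    \<open>sum_min_PiE\<close> with \<open>f = \<sigma> e\<close>.\<close>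
  also have "\<dots> = (\<Sum>e\<in>prims. prim_dim e * (\<Sum>g\<in>prims \<rightarrow>\<^sub>E {..2}. real (min (g e) (2 - g (\<sigma> e)))))"
    by (subst sum.swap) (simp add: sum_distrib_left)
  also have "\<dots> = (\<Sum>e\<in>prims. prim_dim e * (if \<sigma> e = e then 1 / 3 else 5 / 9)) * 3 ^ card prims"
    unfolding sum_distrib_right
    by (rule sum.cong[OF refl])
      (simp only: sum_min_PiE[OF prims_finite _ \<sigma>_prims] eq_commute[of _ "\<sigma> _"] mult.assoc)
  finally show ?thesis by (simp add: card)
qed

end

section \<open>Cyclic codes as ideals\<close>

lemma Z4_cases:
  fixes a :: 4
  obtains "a = 0" | "a = 1" | "a = 2" | "a = 3"
proof (induct a)
  case (of_int z)
  then have "0 \<le> z" "z < 4" by simp_all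
  then have "z = 0 \<or> z = 1 \<or> z = 2 \<or> z = 3" by arith
  then show ?case using of_int by auto
qed

lemma Z4_two_sq: "2 * (a * a) = 2 * (a :: 4)"
  by (rule Z4_cases[of a]) simp_all

lemma Z4_ann_two:
  assumes "2 * a = (0 :: 4)" shows "\<exists>b. a = 2 * b"
proof (rule Z4_cases[of a])
  assume "a = 2"
  then have "a = 2 * 1" by simp
  then show ?thesis by blast
next
  assume "a = 0"
  then have "a = 2 * 0" by simp
  then show ?thesis by blast
qed (use assms in auto)

lemma of_Z4_add: "of_Z4 (a + b) = of_Z4 a + of_Z4 b"
  by transfer simp

lemma of_Z4_mult: "of_Z4 (a * b) = of_Z4 a * of_Z4 b"
  by transfer simp

lemma of_Z4_0: "of_Z4 0 = 0"
  by transfer simp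

lemma of_Z4_1: "of_Z4 1 = 1"
  by transfer simp

lemma of_Z4_two: "of_Z4 (2 * a) = 2 * of_Z4 a"
  by (simp only: mult_2 of_Z4_add)

lemma Z4v_four: "(4 :: Z4v) = 0"
proof -
  have "(4 :: Z4v) = 2 * (2 * of_Z4 1)" by (simp add: of_Z4_1)
  also have "\<dots> = of_Z4 (2 * (2 * 1))" by (simp only: of_Z4_two)
  also have "2 * (2 * 1) = (0 :: 4)" by simp
  finally show ?thesis by (simp add: of_Z4_0)
qed

text \<open>Modulo 2 the ring is Boolean: squaring fixes both coordinates and \<open>v_elem\<close>,
  and the mixed term carries the factor 4.\<close>

lemma Z4v_two_sq: "2 * (r * r) = 2 * (r :: Z4v)"
proof -
  obtain a b where r: "r = of_Z4 a + of_Z4 b * v_elem" using Z4v_repr[of r] by blast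
  have sq: "2 * (of_Z4 a * of_Z4 a) = 2 * of_Z4 a" for a
    by (simp only: of_Z4_mult[symmetric] of_Z4_two[symmetric] Z4_two_sq)
  have "2 * (r * r) = 2 * (of_Z4 a * of_Z4 a) + 4 * (of_Z4 a * of_Z4 b * v_elem)
      + 2 * (of_Z4 b * of_Z4 b) * (v_elem * v_elem)"
    by (simp add: r algebra_simps)
  also have "\<dots> = 2 * r" unfolding sq v_elem_idem Z4v_four by (simp add: r algebra_simps)
  finally show ?thesis .
qed

lemma Z4v_ann_two:
  assumes "2 * r = (0 :: Z4v)" shows "\<exists>s. r = 2 * s"
proof -
  obtain a b where r: "r = of_Z4 a + of_Z4 b * v_elem" using Z4v_repr[of r] by blast
  have "of_Z4 (2 * a) + of_Z4 (2 * b) * v_elem = 2 * r"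
    by (simp only: of_Z4_two r distrib_left mult.assoc)
  also have "\<dots> = of_Z4 0 + of_Z4 0 * v_elem" by (simp add: assms of_Z4_0)
  finally have "(2 * a, 2 * b) = (0, 0)"
    using Z4v_repr[of "of_Z4 0 + of_Z4 0 * v_elem"] by blast
  then obtain c d where "a = 2 * c" "b = 2 * d" using Z4_ann_two by blast
  then have "r = 2 * (of_Z4 c + of_Z4 d * v_elem)"
    by (simp only: r of_Z4_two distrib_left mult.assoc)
  then show ?thesis by blast
qed

text \<open>The product over all \<open>n\<close> of the rings \<open>R[x]/(x\<^sup>n - 1)\<close>: a single type in which each of these
  rings is an ideal generated by an idempotent, although \<open>n\<close> is a term.\<close>

quotient_type cyc = "nat \<Rightarrow> Z4v poly" / "\<lambda>f g. \<forall>n. monom 1 n - 1 dvd f n - g n"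
proof (intro equivpI reflpI sympI transpI)
  fix f g h :: "nat \<Rightarrow> Z4v poly"
  show "\<forall>n. monom 1 n - 1 dvd f n - f n" by simp
  show "\<forall>n. monom 1 n - 1 dvd g n - f n" if "\<forall>n. monom 1 n - 1 dvd f n - g n"
    using that by (metis dvd_minus_iff minus_diff_eq)
  show "\<forall>n. monom 1 n - 1 dvd f n - h n"
    if "\<forall>n. monom 1 n - 1 dvd f n - g n" "\<forall>n. monom 1 n - 1 dvd g n - h n"
  proof
    fix n
    have "monom 1 n - 1 dvd (f n - g n) + (g n - h n)" using that by (blast intro: dvd_add)
    then show "monom 1 n - 1 dvd f n - h n" by simp
  qed
qed

instantiation cyc :: comm_ring_1
begin

lift_definition zero_cyc :: cyc is "\<lambda>_. 0" .
lift_definition one_cyc :: cyc is "\<lambda>_. 1" .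

lift_definition plus_cyc :: "cyc \<Rightarrow> cyc \<Rightarrow> cyc" is "\<lambda>f g n. f n + g n"
  by (simp add: add_diff_add dvd_add)

lift_definition uminus_cyc :: "cyc \<Rightarrow> cyc" is "\<lambda>f n. - f n"
  by (metis dvd_minus_iff minus_diff_minus)

lift_definition minus_cyc :: "cyc \<Rightarrow> cyc \<Rightarrow> cyc" is "\<lambda>f g n. f n - g n"
proof -
  fix f f' g g' :: "nat \<Rightarrow> Z4v poly" and n
  assume "\<And>n. monom 1 n - 1 dvd f n - f' n" "\<And>n. monom 1 n - 1 dvd g n - g' n"
  then have "monom 1 n - 1 dvd (f n - f' n) - (g n - g' n)" by (rule dvd_diff)
  then show "monom 1 n - 1 dvd f n - g n - (f' n - g' n)" by (simp add: algebra_simps)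
qed

lift_definition times_cyc :: "cyc \<Rightarrow> cyc \<Rightarrow> cyc" is "\<lambda>f g n. f n * g n"
proof -
  fix f f' g g' :: "nat \<Rightarrow> Z4v poly" and n
  assume "\<And>n. monom 1 n - 1 dvd f n - f' n" "\<And>n. monom 1 n - 1 dvd g n - g' n"
  then have "monom 1 n - 1 dvd (f n - f' n) * g n + f' n * (g n - g' n)"
    by (intro dvd_add dvd_mult dvd_mult2)
  then show "monom 1 n - 1 dvd f n * g n - f' n * g' n" by (simp add: algebra_simps)
qed

instance
proof
  show "(0::cyc) \<noteq> 1"
    \<comment> \<open>At index 0 the modulus \<open>monom 1 0 - 1\<close> is 0, so that factor is
      the whole polynomial ring and separates 0 from 1.\<close>
    by transfer (auto intro!: exI[of _ 0] simp: monom_0)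
qed (transfer; simp add: algebra_simps)+

end

section \<open>The factors R[x]/(x^n - 1) and substitution of powers\<close>

text \<open>The inclusion of one factor respects sums and products but sends 1 to the idempotent
  \<open>emb n 1\<close>, not to 1.\<close>

definition emb :: "nat \<Rightarrow> Z4v poly \<Rightarrow> cyc" where
  "emb n p = abs_cyc (\<lambda>m. if m = n then p else 0)"

lemma pcompose_monom_monom: "pcompose (monom 1 l) (monom 1 k) = (monom 1 (l * k) :: 'a::comm_ring_1 poly)"
proof (induction l)
  case 0
  have "monom 1 0 = (1 :: 'a poly)" by (simp add: monom_0)
  then show ?case by (simp add: pcompose_1)
qed (simp add: monom_Suc pcompose_pCons mult_monom)

text \<open>The substitution x \<mapsto> x^k is well defined because x^n - 1 divides x^(nk) -
  1.\<close>

lift_definition subst_pow :: "nat \<Rightarrow> cyc \<Rightarrow> cyc" is "\<lambda>k f n. pcompose (f n) (monom 1 k)"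
proof -
  fix k n :: nat and f g :: "nat \<Rightarrow> Z4v poly"
  assume "\<And>n. monom 1 n - 1 dvd f n - g n"
  then obtain s where s: "f n - g n = (monom 1 n - 1) * s" by (blast elim: dvdE)
  have "pcompose (monom 1 n) (monom 1 k) = (monom 1 n ^ k :: Z4v poly)"
    by (simp only: pcompose_monom_monom monom_power power_one mult.commute)
  then have "pcompose (f n - g n) (monom 1 k) = (monom 1 n ^ k - 1) * pcompose s (monom 1 k)"
    by (simp add: s pcompose_mult pcompose_diff pcompose_1)
  moreover have "(monom 1 n - 1 :: Z4v poly) dvd monom 1 n ^ k - 1"
    by (simp add: power_diff_1_eq)
  ultimately show "monom 1 n - 1 dvd pcompose (f n) (monom 1 k) - pcompose (g n) (monom 1 k)"
    by (simp add: pcompose_diff)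
qed

lemma emb_eq_iff: "emb n p = emb n q \<longleftrightarrow> monom 1 n - 1 dvd p - q"
  by (auto simp: emb_def cyc.abs_eq_iff)

lemma emb_add: "emb n (p + q) = emb n p + emb n q"
  unfolding emb_def plus_cyc.abs_eq by (rule arg_cong[of _ _ abs_cyc]) auto

lemma emb_mult: "emb n (p * q) = emb n p * emb n q"
  unfolding emb_def times_cyc.abs_eq by (rule arg_cong[of _ _ abs_cyc]) auto

lemma emb_0: "emb n 0 = 0"
  unfolding emb_def zero_cyc_def by simp

lemmas emb_hom = emb_add emb_mult emb_0

lemma emb_two: "2 * emb n p = emb n (2 * p)"
  by (simp only: mult_2 emb_add)

lemma emb_unit_iff: "emb n 1 * a = a \<longleftrightarrow> (\<exists>p. a = emb n p)"
proof
  have "\<exists>f. a = abs_cyc f" by (induct a rule: cyc.abs_induct) blast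
  then obtain f where "a = abs_cyc f" by blast
  then have "emb n 1 * a = emb n (f n)"
    unfolding emb_def by (simp only: times_cyc.abs_eq) (rule arg_cong[of _ _ abs_cyc], auto)
  then show "\<exists>p. a = emb n p" if "emb n 1 * a = a" using that by metis
qed (auto simp: emb_mult[symmetric])

lemma subst_pow_hom: "comm_ring_hom (subst_pow k)"
  by standard (transfer; simp add: pcompose_add pcompose_mult pcompose_1)+

interpretation subst_pow: comm_ring_hom "subst_pow k" for k
  by (rule subst_pow_hom)

lemma subst_pow_emb: "subst_pow k (emb n p) = emb n (pcompose p (monom 1 k))"
  unfolding emb_def subst_pow.abs_eq by (rule arg_cong[of _ _ abs_cyc]) auto

lemma subst_pow_subst_pow: "subst_pow k (subst_pow l a) = subst_pow (l * k) a"
  by transfer (simp add: pcompose_assoc[symmetric] pcompose_monom_monom)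

text \<open>As the coefficients form a Boolean ring modulo 2, squaring a polynomial modulo 2 only
  substitutes x^2 for x.\<close>

lemma Z4v_poly_frobenius: "2 * pcompose p (monom 1 2) = 2 * (p * p)" for p :: "Z4v poly"
proof (induction p)
  case (pCons a p)
  have m: "monom 1 2 = ([:0, 1:] * [:0, 1:] :: Z4v poly)"
    by (simp add: numeral_2_eq_2 monom_Suc monom_0)
  have four: "4 = (0 :: Z4v poly)" by (simp add: numeral_poly Z4v_four)
  have c: "2 * [:a:] = 2 * ([:a:] * [:a:])" 
  proof -
    have "2 * [:b:] = [:2 * b:]" for b :: Z4v by (simp only: mult_2) simp
    then show ?thesis using Z4v_two_sq[of a] by simp
  qed
  have p: "pCons a p = [:a:] + [:0, 1:] * p" by simp
  have "2 * pcompose (pCons a p) (monom 1 2) = 2 * [:a:] + [:0, 1:] * [:0, 1:] * (2 * pcompose p (monom 1 2))"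
    unfolding pcompose_pCons m by (simp only: distrib_left mult_ac)
  also have "\<dots> = 2 * ([:a:] * [:a:]) + [:0, 1:] * [:0, 1:] * (2 * (p * p))" unfolding pCons.IH c ..
  \<comment> \<open>The mixed term, zero because of its factor 4, is inserted to complete the
    square.\<close>
  also have "\<dots> = 2 * ([:a:] * [:a:]) + [:0, 1:] * [:0, 1:] * (2 * (p * p)) + 4 * ([:a:] * [:0, 1:] * p)"
    unfolding four by simp
  also have "\<dots> = 2 * (([:a:] + [:0, 1:] * p) * ([:a:] + [:0, 1:] * p))"
    by (simp only: distrib_left distrib_right mult_ac add_ac numeral_Bit0 mult_1 one_add_one[symmetric] mult_1_right)
  finally show ?case unfolding p .
qed simp

section \<open>Indices modulo n and iterated shifts\<close>

text \<open>Here and below \<open>n - 1\<close> plays the part of -1 modulo \<open>n\<close>, which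
  keeps indices and exponents natural numbers.\<close>

lemma cong_pred_sq: "n > 0 \<Longrightarrow> [(n - 1) * (n - 1) = 1] (mod n)" for n :: nat
proof (cases "n = 1")
  case False
  assume "n > 0"
  with False have "n \<ge> 2" by simp
  then obtain m where n: "n = Suc (Suc m)" by (metis add_2_eq_Suc le_Suc_ex)
  have "(n - 1) * (n - 1) = 1 + m * n" by (simp add: n)
  then show ?thesis unfolding cong_def by (simp only: mod_mult_self1)
qed simp

lemma bij_betw_add_mod:
  assumes "n > 0" shows "bij_betw (\<lambda>i. (i + k) mod n) {..<n} {..<n :: nat}"
proof -
  have "inj_on (\<lambda>i. (i + k) mod n) {..<n}"
    by (rule inj_onI) (metis cong_def cong_add_rcancel_nat cong_less_modulus_unique_nat lessThan_iff)
  moreover have "(\<lambda>i. (i + k) mod n) ` {..<n} \<subseteq> {..<n}" using assms by auto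
  ultimately show ?thesis by (simp add: bij_betw_def endo_inj_surj)
qed

lemma mod_add_mult_mod: "(i + j mod n * k) mod n = (i + j * k) mod n" for n :: nat
  by (metis mod_add_right_eq mod_mult_left_eq)

lemma cong_reflect_twice:
  fixes n i t :: nat
  assumes "n > 0" shows "[i + (i + t * (n - 1)) * (n - 1) = t] (mod n)"
proof -
  have "i + (i + t * (n - 1)) * (n - 1) = i * n + t * ((n - 1) * (n - 1))"
    using assms by (cases n) (simp_all add: algebra_simps)
  also have "[\<dots> = 0 + t * 1] (mod n)"
    by (intro cong_add cong_mult cong_pred_sq assms) (simp_all add: cong_def)
  finally show ?thesis by simp
qed

text \<open>The map is the reflection t \<mapsto> i - t, its own inverse.\<close>

lemma bij_betw_reflect_mod:
  assumes "n > 0" shows "bij_betw (\<lambda>t. (i + t * (n - 1)) mod n) {..<n} {..<n :: nat}"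
proof -
  have "(i + (i + t * (n - 1)) mod n * (n - 1)) mod n = t" if "t < n" for t
    using cong_reflect_twice[OF assms, of i t] that
    by (simp add: cong_def mod_add_mult_mod)
  then show ?thesis using assms by (intro bij_betw_byWitness[of _ "\<lambda>t. (i + t * (n - 1)) mod n"]) auto
qed

lemma cyclic_shift_carrier: "c \<in> carrier_vec n \<Longrightarrow> cyclic_shift c \<in> carrier_vec n"
  by (auto simp: cyclic_shift_def)

lemma cyclic_shift_funpow:
  assumes "c \<in> carrier_vec n" "n > 0"
  shows "(cyclic_shift ^^ k) c = vec n (\<lambda>i. c $ ((i + k * (n - 1)) mod n))"
proof (induction k)
  case 0
  show ?case using assms by (auto simp: vec_eq_iff)
next
  case (Suc k)
  have "((i + (n - 1)) mod n + k * (n - 1)) mod n = (i + (n - 1 + k * (n - 1))) mod n" for i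
    by (simp add: mod_simps add.assoc)
  then show ?case unfolding funpow.simps comp_apply Suc
    using assms by (intro eq_vecI) (simp_all add: cyclic_shift_def)
qed

section \<open>Words as ring elements\<close>

locale cyclic_length =
  fixes n :: nat
  assumes n_pos: "n > 0"
begin

abbreviation U :: "cyc" where "U \<equiv> emb n 1"

definition X :: cyc where
  "X = emb n (monom 1 1)"

definition word :: "Z4v vec \<Rightarrow> cyc" where
  "word c = emb n (\<Sum>i<n. monom (c $ i) i)"

lemma UU: "U * U = U"
  by (simp add: emb_mult[symmetric])

lemma U_emb: "U * emb n p = emb n p"
  by (simp add: emb_mult[symmetric])

lemma emb_monom: "emb n (monom r i) = emb n [:r:] * X ^ i"
proof (induction i)
  case (Suc i)
  have "monom r (Suc i) = monom r i * monom 1 1" by (simp add: mult_monom)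
  then show ?case by (simp add: emb_hom Suc X_def mult_ac)
qed (simp add: monom_0)

lemma emb_pCons: "emb n (pCons a p) = emb n [:a:] + X * emb n p"
proof -
  have "pCons a p = [:a:] + monom 1 1 * p" by (simp add: monom_Suc monom_0)
  then show ?thesis by (simp only: emb_hom X_def)
qed

lemma U_X: "U * X = X"
  by (simp add: X_def U_emb)

lemma X_pow_n: "X ^ n = U"
proof -
  have "emb n (monom 1 n) = emb n 1" by (simp add: emb_eq_iff)
  moreover have "emb n (monom 1 n) = U * X ^ n" by (simp only: emb_monom[of 1 n] one_pCons)
  moreover have "U * X ^ n = X ^ n"
    using n_pos U_X by (cases n) (simp_all add: mult.assoc[symmetric])
  ultimately show ?thesis by simp
qed

text \<open>The factor \<open>a\<close> is there because \<open>X ^ 0\<close> is 1 while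
  \<open>X ^ n\<close> is only \<open>U\<close>.\<close>

lemma X_pow_cong:
  assumes "[i = j] (mod n)" "U * a = a" shows "X ^ i * a = X ^ j * a"
proof -
  have "X ^ (k * n + l) * a = X ^ l * a" for k l
  proof (induction k)
    case (Suc k)
    have "X ^ (Suc k * n + l) * a = U * (X ^ (k * n + l) * a)"
      by (simp add: power_add X_pow_n mult_ac)
    then show ?case using Suc assms(2) by (metis mult.left_commute)
  qed simp
  then have "X ^ i * a = X ^ (i mod n) * a" for i by (metis div_mult_mod_eq)
  then show ?thesis using assms(1) by (metis cong_def)
qed

lemma word_sum: "word c = (\<Sum>i<n. emb n [:c $ i:] * X ^ i)"
proof -
  have "emb n (sum f I) = (\<Sum>i\<in>I. emb n (f i))" for f and I :: "nat set"
    by (induction I rule: infinite_finite_induct) (simp_all add: emb_hom)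
  then show ?thesis unfolding word_def by (simp only: emb_monom[symmetric])
qed

lemma U_word: "U * word c = word c"
  by (simp add: word_def U_emb)

lemma emb_const_hom: "emb n [:a + b:] = emb n [:a:] + emb n [:b:]" "emb n [:a * b:] = emb n [:a:] * emb n [:b:]"
  using emb_add[of n "[:a:]" "[:b:]"] emb_mult[of n "[:a:]" "[:b:]"] by (simp_all add: mult.commute)

lemma word_add: "c \<in> carrier_vec n \<Longrightarrow> d \<in> carrier_vec n \<Longrightarrow> word (c + d) = word c + word d"
  by (simp add: word_sum emb_const_hom distrib_right sum.distrib)

lemma word_smult: "c \<in> carrier_vec n \<Longrightarrow> word (r \<cdot>\<^sub>v c) = emb n [:r:] * word c"
  by (simp add: word_sum emb_const_hom sum_distrib_left mult.assoc)

lemma word_zero: "word (0\<^sub>v n) = 0"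
  by (simp add: word_sum emb_hom)

lemma word_inj: "inj_on word (carrier_vec n)"
proof (rule inj_onI)
  fix c d :: "Z4v vec"
  assume cd: "c \<in> carrier_vec n" "d \<in> carrier_vec n" "word c = word d"
  define p where "p = (\<Sum>i<n. monom (c $ i) i) - (\<Sum>i<n. monom (d $ i) i)"
  have coeff: "coeff p i = (if i < n then c $ i - d $ i else 0)" for i
    by (simp add: p_def coeff_sum)
  from cd(3) obtain s where s: "p = (monom 1 n - 1) * s"
    by (auto simp: word_def emb_eq_iff p_def elim: dvdE)
  have "s = 0"
  proof (rule ccontr)
    assume "s \<noteq> 0"
    \<comment> \<open>As x^n - 1 is monic, the top coefficient of \<open>s\<close> survives in the
      product despite zero divisors, at a degree where \<open>p\<close> vanishes.\<close>
    have "coeff p (n + degree s) = lead_coeff s - coeff s (n + degree s)"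
      by (simp add: s left_diff_distrib coeff_monom_mult)
    also have "coeff s (n + degree s) = 0" using n_pos by (intro coeff_eq_0) simp
    finally show False using coeff[of "n + degree s"] \<open>s \<noteq> 0\<close> by simp
  qed
  then have "coeff p i = 0" for i by (simp add: s)
  then show "c = d" using cd(1,2) coeff by (intro eq_vecI) (auto, metis eq_iff_diff_eq_0)
qed

lemma word_eq_0_iff: "c \<in> carrier_vec n \<Longrightarrow> word c = 0 \<longleftrightarrow> c = 0\<^sub>v n"
  using word_inj word_zero by (metis inj_onD zero_carrier_vec)

lemma word_shift:
  assumes "c \<in> carrier_vec n" shows "word (cyclic_shift c) = X * word c"
proof -
  have "X * word c = (\<Sum>i<n. X ^ (i + 1) * emb n [:c $ i:])"
    by (simp add: word_sum sum_distrib_left mult_ac)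
  also have "\<dots> = (\<Sum>i<n. X ^ ((i + (n - 1)) mod n + 1) * emb n [:c $ ((i + (n - 1)) mod n):])"
    by (rule sum.reindex_bij_betw[OF bij_betw_add_mod[OF n_pos], symmetric])
  also have "\<dots> = (\<Sum>i<n. X ^ i * emb n [:c $ ((i + (n - 1)) mod n):])"
  proof (rule sum.cong[OF refl], rule X_pow_cong[OF _ U_emb])
    fix i
    have "[(i + (n - 1)) mod n + 1 = i + n] (mod n)" using n_pos by (simp add: cong_def mod_simps)
    then show "[(i + (n - 1)) mod n + 1 = i] (mod n)" by (simp add: cong_def)
  qed
  finally show ?thesis using assms by (simp add: word_sum cyclic_shift_def mult.commute)
qed

lemma word_shift_pow:
  "c \<in> carrier_vec n \<Longrightarrow> (cyclic_shift ^^ k) c \<in> carrier_vec n \<and> word ((cyclic_shift ^^ k) c) = X ^ k * word c"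
  by (induction k) (simp_all add: cyclic_shift_carrier word_shift mult.assoc)

text \<open>Horner's scheme: multiplication by x is the cyclic shift, so reduction modulo x^n - 1
  needs no division.\<close>

lemma emb_word: "\<exists>c\<in>carrier_vec n. emb n p = word c"
proof (induction p)
  case 0
  show ?case by (rule bexI[of _ "0\<^sub>v n"]) (simp_all add: word_zero emb_hom)
next
  case (pCons a p)
  then obtain c where c: "c \<in> carrier_vec n" "emb n p = word c" by blast
  have "word (unit_vec n 0) = (\<Sum>i<n. if i = 0 then U else 0)"
    unfolding word_sum by (rule sum.cong) (auto simp: emb_hom)
  then have "word (unit_vec n 0) = U" using n_pos by simp
  then have "emb n (pCons a p) = word (a \<cdot>\<^sub>v unit_vec n 0 + cyclic_shift c)"
    using c by (simp add: emb_pCons[of a p] word_add word_smult word_shift cyclic_shift_carrier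
        mult.commute[of _ U] U_emb)
  then show ?case using c by (intro bexI[of _ "a \<cdot>\<^sub>v unit_vec n 0 + cyclic_shift c"]) (simp_all add: cyclic_shift_carrier)
qed

lemma unit_iff_word: "U * a = a \<longleftrightarrow> a \<in> word ` carrier_vec n"
  unfolding emb_unit_iff using emb_word U_word[unfolded emb_unit_iff] by blast

lemma subst_U: "subst_pow k U = U"
  by (simp add: subst_pow_emb pcompose_1)

lemma subst_const: "subst_pow k (emb n [:a:]) = emb n [:a:]"
  by (simp add: subst_pow_emb)

lemma subst_X: "subst_pow k X = U * X ^ k"
proof -
  have "pcompose (monom 1 1) (monom 1 k) = (monom 1 k :: Z4v poly)"
    by (simp add: pcompose_monom_monom del: One_nat_def)
  then show ?thesis by (simp add: X_def subst_pow_emb emb_monom[of 1 k])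
qed

lemma subst_unit: "U * a = a \<Longrightarrow> U * subst_pow k a = subst_pow k a"
  by (metis subst_U subst_pow.hom_mult)

text \<open>\<open>subst_pow k a\<close> is a polynomial evaluated at \<open>X ^ k\<close>, so on
  the component of \<open>e\<close> it depends only on \<open>X ^ k * e\<close>.\<close>

lemma subst_pow_eqI:
  assumes "X ^ k * e = X ^ l * e" "U * a = a"
  shows "subst_pow k a * e = subst_pow l a * e"
proof -
  obtain p where a: "a = emb n p" using assms(2) emb_unit_iff by blast
  show ?thesis unfolding a
  proof (induction p)
    case (pCons b p)
    have "subst_pow i (emb n (pCons b p)) * e = emb n [:b:] * e + U * (X ^ i * e) * subst_pow i (emb n p)" for i
      by (simp add: emb_pCons[of b p] subst_pow.hom_add subst_pow.hom_mult subst_const subst_X algebra_simps)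
    moreover have "U * (X ^ k * e) * subst_pow k (emb n p) = U * X ^ l * (subst_pow k (emb n p) * e)"
      unfolding assms(1) by (simp add: mult_ac)
    moreover have "U * (X ^ l * e) * subst_pow l (emb n p) = U * X ^ l * (subst_pow l (emb n p) * e)"
      by (simp add: mult_ac)
    ultimately show ?case using pCons.IH by simp
  qed (simp add: emb_hom)
qed

lemma subst_pow_cong:
  assumes "[k = l] (mod n)" "U * a = a" shows "subst_pow k a = subst_pow l a"
proof -
  have "subst_pow k a * U = subst_pow l a * U"
    by (rule subst_pow_eqI[OF X_pow_cong[OF assms(1) UU] assms(2)])
  then show ?thesis using subst_unit[OF assms(2)] by (simp add: mult.commute)
qed

lemma subst_pow_1:
  assumes "U * a = a" shows "subst_pow 1 a = a"
proof -
  obtain p where "a = emb n p" using assms emb_unit_iff by blast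
  moreover have "monom 1 1 = ([:0, 1:] :: Z4v poly)" by (simp add: monom_Suc monom_0)
  ultimately show ?thesis by (simp only: subst_pow_emb pcompose_idR)
qed

lemma frobenius:
  assumes "U * a = a" shows "2 * subst_pow (2 ^ i) a = 2 * a ^ 2 ^ i"
proof (induction i)
  case 0
  then show ?case using subst_pow_1[OF assms] by simp
next
  case (Suc i)
  have f: "2 * subst_pow 2 b = 2 * (b * b)" if b: "U * b = b" for b
  proof -
    obtain p where "b = emb n p" using b emb_unit_iff by blast
    then show ?thesis by (simp add: subst_pow_emb emb_two Z4v_poly_frobenius emb_mult[symmetric])
  qed
  define b where "b = subst_pow (2 ^ i) a"
  note IH = Suc[folded b_def]
  have "2 * subst_pow (2 ^ Suc i) a = 2 * subst_pow 2 b"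
    unfolding b_def subst_pow_subst_pow by (simp add: mult.commute)
  also have "\<dots> = 2 * (b * b)" using f[of b] subst_unit[OF assms] by (simp add: b_def)
  \<comment> \<open>The induction hypothesis identifies \<open>b\<close> and
    \<open>a ^ 2 ^ i\<close> only modulo 2, so the factor 2 is moved to each copy of
    \<open>b\<close> in turn.\<close>
  also have "\<dots> = b * (2 * b)" by (simp only: mult_ac)
  also have "\<dots> = b * (2 * a ^ 2 ^ i)" by (simp only: IH)
  also have "\<dots> = a ^ 2 ^ i * (2 * b)" by (simp only: mult_ac)
  also have "\<dots> = a ^ 2 ^ i * (2 * a ^ 2 ^ i)" by (simp only: IH)
  also have "\<dots> = 2 * (a ^ 2 ^ i * a ^ 2 ^ i)" by (simp only: mult_ac)
  also have "a ^ 2 ^ i * a ^ 2 ^ i = a ^ 2 ^ Suc i"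
    by (simp only: power_Suc2 power_mult power2_eq_square)
  finally show ?case .
qed

section \<open>Codes, ideals and inner products\<close>

text \<open>The coefficient of x^t in h(x) k(x^-1) collects the products h_i k_(i-t), which is the
  inner product of h with the t-th shift of k.\<close>

lemma word_mult_dual:
  assumes "h \<in> carrier_vec n" "k \<in> carrier_vec n"
  shows "word h * subst_pow (n - 1) (word k) = word (vec n (\<lambda>t. h \<bullet> (cyclic_shift ^^ t) k))"
proof -
  have emb_sum: "emb n [:sum f I:] = (\<Sum>i\<in>I. emb n [:f i:])" for f and I :: "nat set"
    by (induction I rule: infinite_finite_induct) (simp_all add: emb_hom emb_const_hom)
  have "subst_pow (n - 1) (word k) = (\<Sum>j<n. emb n [:k $ j:] * (U * X ^ (n - 1)) ^ j)"
    by (simp add: word_sum subst_pow.hom_sum subst_pow.hom_mult subst_pow.hom_power subst_const subst_X)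
  also have "\<dots> = (\<Sum>j<n. emb n [:k $ j:] * X ^ (j * (n - 1)))"
  proof (rule sum.cong[OF refl])
    fix j
    have "a * U ^ j = a" if "U * a = a" for a
      by (induction j) (use that in \<open>simp_all add: power_Suc2 mult.assoc[symmetric] mult.commute[of a U] del: power_Suc\<close>)
    then show "emb n [:k $ j:] * (U * X ^ (n - 1)) ^ j = emb n [:k $ j:] * X ^ (j * (n - 1))"
      using U_emb by (simp add: power_mult_distrib power_mult[symmetric] mult.assoc[symmetric] mult.commute[of j])
  qed
  finally have "word h * subst_pow (n - 1) (word k) =
      (\<Sum>i<n. \<Sum>j<n. X ^ (i + j * (n - 1)) * emb n [:h $ i * k $ j:])"
    by (simp add: word_sum sum_product emb_const_hom power_add mult_ac)
  \<comment> \<open>Substituting j = i - t turns the exponent i - j into t.\<close>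
  also have "\<dots> = (\<Sum>i<n. \<Sum>t<n. X ^ t * emb n [:h $ i * k $ ((i + t * (n - 1)) mod n):])"
  proof (rule sum.cong[OF refl])
    fix i
    have "(\<Sum>j<n. X ^ (i + j * (n - 1)) * emb n [:h $ i * k $ j:]) =
        (\<Sum>t<n. X ^ (i + (i + t * (n - 1)) mod n * (n - 1)) * emb n [:h $ i * k $ ((i + t * (n - 1)) mod n):])"
      by (rule sum.reindex_bij_betw[OF bij_betw_reflect_mod[OF n_pos], symmetric])
    also have "\<dots> = (\<Sum>t<n. X ^ t * emb n [:h $ i * k $ ((i + t * (n - 1)) mod n):])"
    proof (rule sum.cong[OF refl], rule X_pow_cong[OF _ U_emb])
      fix t
      show "[i + (i + t * (n - 1)) mod n * (n - 1) = t] (mod n)"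
        using cong_reflect_twice[OF n_pos, of i t] by (simp add: cong_def mod_add_mult_mod)
    qed
    finally show "(\<Sum>j<n. X ^ (i + j * (n - 1)) * emb n [:h $ i * k $ j:]) =
      (\<Sum>t<n. X ^ t * emb n [:h $ i * k $ ((i + t * (n - 1)) mod n):])" .
  qed
  also have "\<dots> = (\<Sum>t<n. \<Sum>i<n. X ^ t * emb n [:h $ i * k $ ((i + t * (n - 1)) mod n):])"
    by (rule sum.swap)
  also have "\<dots> = word (vec n (\<lambda>t. h \<bullet> (cyclic_shift ^^ t) k))"
    using assms n_pos
    by (simp add: word_sum cyclic_shift_funpow scalar_prod_def emb_sum sum_distrib_left sum_distrib_right
        lessThan_atLeast0 mult.commute)
  finally show ?thesis .
qed

lemma word_image_ideal:
  assumes "C \<in> cyclic_codes n" shows "word ` C \<in> ideals_below U"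
proof -
  have C: "C \<subseteq> carrier_vec n" "0\<^sub>v n \<in> C" "\<And>x y. x \<in> C \<Longrightarrow> y \<in> C \<Longrightarrow> x + y \<in> C"
    "\<And>r x. x \<in> C \<Longrightarrow> r \<cdot>\<^sub>v x \<in> C" "\<And>x. x \<in> C \<Longrightarrow> cyclic_shift x \<in> C"
    using assms by (auto simp: cyclic_codes_def linear_code_iff)
  have add: "a + b \<in> word ` C" if "a \<in> word ` C" "b \<in> word ` C" for a b
  proof -
    from that obtain c d where cd: "c \<in> C" "d \<in> C" "a = word c" "b = word d" by blast
    then have "a + b = word (c + d)" using C(1) word_add by (simp add: subset_iff)
    then show ?thesis using C(3)[OF cd(1,2)] by simp
  qed
  have zero: "0 \<in> word ` C" using C(2) word_zero by (metis image_eqI)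
  have const: "emb n [:r:] * a \<in> word ` C" if "a \<in> word ` C" for r a
  proof -
    from that obtain c where c: "c \<in> C" "a = word c" by blast
    then have "emb n [:r:] * a = word (r \<cdot>\<^sub>v c)" using C(1) word_smult by (simp add: subset_iff)
    then show ?thesis using C(4)[OF c(1)] by simp
  qed
  have X: "X ^ i * a \<in> word ` C" if "a \<in> word ` C" for i a
  proof (induction i)
    case (Suc i)
    then obtain c where c: "c \<in> C" "X ^ i * a = word c" by blast
    then have "X ^ Suc i * a = word (cyclic_shift c)" using C(1) word_shift by (auto simp: mult.assoc)
    then show ?case using C(5)[OF c(1)] by blast
  qed (use that in simp)
  have sum: "sum f I \<in> word ` C" if "\<And>i. f i \<in> word ` C" for f and I :: "nat set"
    by (induction I rule: infinite_finite_induct) (simp_all add: zero add that)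
  have "r * a \<in> word ` C" if a: "a \<in> word ` C" for r a
  proof -
    \<comment> \<open>Only the part of \<open>r\<close> below \<open>U\<close> acts on the code, and
      it is a combination of powers of \<open>X\<close> with constant coefficients.\<close>
    have "U * (U * r) = U * r" using UU by (simp add: mult.assoc[symmetric])
    then obtain d where d: "U * r = word d" using unit_iff_word by blast
    have "r * a = (U * r) * a" using a U_word by (auto simp: mult_ac)
    also have "\<dots> = (\<Sum>i<n. emb n [:d $ i:] * (X ^ i * a))"
      by (simp add: d word_sum sum_distrib_right mult.assoc)
    finally show ?thesis using sum const X a by simp
  qed
  then show ?thesis using zero add U_word by (auto simp: ideals_below_def)
qed

lemma bij_codes_ideals: "bij_betw ((`) word) (cyclic_codes n) (ideals_below U)"
  unfolding bij_betw_def
proof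
  show "inj_on ((`) word) (cyclic_codes n)"
    by (rule inj_on_subset[OF inj_on_image_Pow[OF word_inj]]) (auto simp: cyclic_codes_def linear_code_iff)
  have "\<exists>C\<in>cyclic_codes n. I = word ` C" if I: "I \<in> ideals_below U" for I
  proof
    let ?C = "{c \<in> carrier_vec n. word c \<in> I}"
    show "?C \<in> cyclic_codes n"
      using I by (auto simp: cyclic_codes_def linear_code_iff ideals_below_def word_add word_smult word_zero
          word_shift cyclic_shift_carrier)
    show "I = word ` ?C" using I unit_iff_word by (auto simp: ideals_below_def)
  qed
  then show "(`) word ` cyclic_codes n = ideals_below U" using word_image_ideal by blast
qed

lemma finite_unit: "finite {a. U * a = a}"
  by (simp add: unit_iff_word finite_carrier_vec)

lemma unit_ann_two:
  assumes "U * a = a" "2 * a = 0" shows "\<exists>b. a = 2 * b"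
proof -
  obtain c where c: "c \<in> carrier_vec n" "a = word c" using assms unit_iff_word by blast
  have w2: "word (2 \<cdot>\<^sub>v d) = 2 * word d" if "d \<in> carrier_vec n" for d
  proof -
    have "emb n [:2:] = 2 * U" by (simp add: emb_two numeral_poly)
    then show ?thesis using that by (simp add: word_smult mult.assoc U_word)
  qed
  then have "2 \<cdot>\<^sub>v c = 0\<^sub>v n" using c assms word_eq_0_iff[of "2 \<cdot>\<^sub>v c"] by simp
  then have "2 * c $ i = 0" if "i < n" for i using that c by (metis carrier_vecD index_smult_vec(1) index_zero_vec(1))
  then have "\<forall>i. \<exists>s. i < n \<longrightarrow> c $ i = 2 * s" using Z4v_ann_two by blast
  then obtain s where "\<And>i. i < n \<Longrightarrow> c $ i = 2 * s i" by metis
  then have "c = 2 \<cdot>\<^sub>v vec n s" using c by (intro eq_vecI) auto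
  then show ?thesis using c w2[of "vec n s"] by auto
qed

lemma four_U: "4 * U = 0"
proof -
  have "4 * U = 2 * (2 * U)" by simp
  also have "\<dots> = emb n 4" unfolding emb_two by simp
  finally show ?thesis by (simp add: numeral_poly Z4v_four emb_hom)
qed

end

section \<open>Odd length\<close>

locale odd_length = cyclic_length +
  assumes n_odd: "odd n"
begin

lemma two_pow_totient_cong: "[2 ^ totient n = 1] (mod n)"
  by (rule euler_theorem) (use n_odd in simp)

text \<open>Oddness gives 2^totient(n) = 1 modulo n, so this iterate of the Frobenius substitution
  is the identity on the factor, whence a^q = a modulo 2.\<close>

sublocale galois_product_involution U "2 ^ totient n" "subst_pow (n - 1)"
proof
  show "2 \<le> (2::nat) ^ totient n"
    using n_pos by (metis One_nat_def Suc_leI power_increasing_iff power_one_right one_less_numeral_iff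
        semiring_norm(76) totient_gt_0_iff)
  show "2 * a ^ 2 ^ totient n = 2 * a" if "U * a = a" for a
    using frobenius[OF that, of "totient n"] subst_pow_cong[OF two_pow_totient_cong that] subst_pow_1[OF that] by simp
  show "subst_pow (n - 1) (subst_pow (n - 1) a) = a" if "U * a = a" for a
    unfolding subst_pow_subst_pow
    using subst_pow_cong[OF cong_pred_sq[OF n_pos] that] subst_pow_1[OF that] by simp
qed (simp_all add: UU finite_unit four_U unit_ann_two subst_pow.hom_add subst_pow.hom_mult subst_U)

text \<open>The ideal-theoretic dual asks for orthogonality to all shifts of all codewords; as the
  code is closed under shifts, this is plain orthogonality.\<close>

lemma word_dual:
  assumes "C \<in> cyclic_codes n"
  shows "word ` code_hull n C = word ` C \<inter> dual_ideal (word ` C)"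
proof -
  have C: "C \<subseteq> carrier_vec n" "\<And>x. x \<in> C \<Longrightarrow> cyclic_shift x \<in> C"
    using assms by (auto simp: cyclic_codes_def linear_code_iff)
  have shift: "(cyclic_shift ^^ t) k \<in> C" if "k \<in> C" for k t
    by (induction t) (use C that in auto)
  have "h \<in> dual_code n C \<longleftrightarrow> word h \<in> dual_ideal (word ` C)" if h: "h \<in> C" for h
  proof -
    have "word h * subst_pow (n - 1) (word k) = 0 \<longleftrightarrow> (\<forall>t<n. h \<bullet> (cyclic_shift ^^ t) k = 0)" if k: "k \<in> C" for k
    proof -
      have "word h * subst_pow (n - 1) (word k) = 0 \<longleftrightarrow> vec n (\<lambda>t. h \<bullet> (cyclic_shift ^^ t) k) = 0\<^sub>v n"
        using word_mult_dual[of h k] h k C(1) word_eq_0_iff[of "vec n (\<lambda>t. h \<bullet> (cyclic_shift ^^ t) k)"]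
        by (simp add: subset_iff)
      then show ?thesis by (auto simp: vec_eq_iff)
    qed
    moreover have "(\<forall>k\<in>C. \<forall>t<n. h \<bullet> (cyclic_shift ^^ t) k = 0) \<longleftrightarrow> (\<forall>k\<in>C. h \<bullet> k = 0)"
      using shift n_pos by (metis funpow_0)
    ultimately show ?thesis unfolding dual_code_def dual_ideal_def using h C(1) by (auto simp: U_word)
  qed
  then show ?thesis by (auto simp: code_hull_def)
qed

lemma avg_hull_dim_prims:
  "avg_hull_dim n = (\<Sum>e\<in>prims. prim_dim e * (if subst_pow (n - 1) e = e then 1 / 3 else 5 / 9))"
proof -
  have "dim2 (code_hull n C) = log 2 (card (word ` C \<inter> dual_ideal (word ` C)))" if "C \<in> cyclic_codes n" for C
  proof -
    have "code_hull n C \<subseteq> carrier_vec n"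
      using that by (auto simp: code_hull_def cyclic_codes_def linear_code_iff)
    then have "card (word ` code_hull n C) = card (code_hull n C)"
      by (intro card_image inj_on_subset[OF word_inj])
    then show ?thesis using word_dual[OF that] by (simp add: dim2_def)
  qed
  then have "(\<Sum>C\<in>cyclic_codes n. dim2 (code_hull n C)) =
      (\<Sum>C\<in>cyclic_codes n. log 2 (card (word ` C \<inter> dual_ideal (word ` C))))" by simp
  also have "\<dots> = (\<Sum>I\<in>ideals_below U. log 2 (card (I \<inter> dual_ideal I)))"
    by (rule sum.reindex_bij_betw[OF bij_codes_ideals])
  finally show ?thesis
    using sum_log_card_hull bij_betw_same_card[OF bij_codes_ideals] by (simp add: avg_hull_dim_def)
qed

end

section \<open>Orders and degrees of the primitive idempotents\<close>

text \<open>Such a word has period \<open>j\<close>, and its first \<open>j\<close> letters are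
  arbitrary because \<open>j\<close> divides \<open>n\<close>.\<close>

lemma card_periodic_words:
  assumes "j dvd n" "n > 0"
  shows "card {c \<in> carrier_vec n :: Z4v vec set. (cyclic_shift ^^ j) c = c} = 16 ^ j"
proof -
  let ?F = "\<lambda>d :: Z4v vec. vec n (\<lambda>i. d $ (i mod j))"
  have j: "j > 0" "j \<le> n" using assms by (auto simp: dvd_pos_nat dvd_imp_le)
  have "bij_betw ?F (carrier_vec j) {c \<in> carrier_vec n. (cyclic_shift ^^ j) c = c}"
  proof (rule bij_betw_byWitness[of _ "\<lambda>c. vec j (\<lambda>i. c $ i)"])
    show "\<forall>d\<in>carrier_vec j. vec j (\<lambda>i. ?F d $ i) = d" using j by auto
    show "(\<lambda>c. vec j (\<lambda>i. c $ i)) ` {c \<in> carrier_vec n :: Z4v vec set. (cyclic_shift ^^ j) c = c} \<subseteq> carrier_vec j"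
      by auto
    show "?F ` carrier_vec j \<subseteq> {c \<in> carrier_vec n. (cyclic_shift ^^ j) c = c}"
    proof safe
      fix d :: "Z4v vec"
      have "((i + j * (n - 1)) mod n) mod j = i mod j" for i
        using assms by (simp add: mod_mod_cancel)
      then show "(cyclic_shift ^^ j) (?F d) = ?F d"
        using assms by (subst cyclic_shift_funpow[of _ n]) (auto simp: vec_eq_iff)
    qed simp
    show "\<forall>c\<in>{c \<in> carrier_vec n. (cyclic_shift ^^ j) c = c}. ?F (vec j (\<lambda>i. c $ i)) = c"
    proof safe
      fix c :: "Z4v vec"
      assume c: "c \<in> carrier_vec n" "(cyclic_shift ^^ j) c = c"
      have per: "c $ i = c $ (i mod j)" if "i < n" for i
        using that
      proof (induction i rule: less_induct)
        case (less i)
        show ?case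
        proof (cases "i < j")
          case False
          have "c $ i = vec n (\<lambda>i. c $ ((i + j * (n - 1)) mod n)) $ i"
            using c(2) unfolding cyclic_shift_funpow[OF c(1) assms(2)] by simp
          also have "\<dots> = c $ ((i + j * (n - 1)) mod n)" using less.prems by simp
          \<comment> \<open>The shifted index is i - j modulo n, so the induction descends by one
            period.\<close>
          also have "i + j * (n - 1) = (i - j) + j * n"
            using False assms(2) by (cases n) (simp_all add: algebra_simps)
          also have "(i - j + j * n) mod n = i - j" using less.prems by simp
          also have "c $ (i - j) = c $ ((i - j) mod j)" using False less j by auto
          finally show ?thesis using False by (simp add: le_mod_geq)
        qed simp
      qed
      show "?F (vec j (\<lambda>i. c $ i)) = c"
        using c(1) j per by (intro eq_vecI) auto
    qed
  qed
  then have "card {c \<in> carrier_vec n :: Z4v vec set. (cyclic_shift ^^ j) c = c} = card (carrier_vec j :: Z4v vec set)"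
    by (rule bij_betw_same_card[symmetric])
  then show ?thesis by (simp add: card_carrier_vec card_Z4v)
qed

text \<open>Invertibility on \<open>Ae\<close> passes to products; needed for the linear factors in
  \<open>self_inverse_primD\<close>.\<close>

lemma (in galois_product) prod_prim_unit:
  assumes "e \<in> prims" "\<And>i. i \<in> I \<Longrightarrow> \<exists>b. f i * b * e = e"
  shows "\<exists>b. prod f I * b * e = e"
  using assms(2)
proof (induction I rule: infinite_finite_induct)
  case (insert i I)
  then obtain b c where bc: "prod f I * b * e = e" "f i * c * e = e" by blast
  have "prod f (insert i I) * (b * c) * e = f i * c * (prod f I * b * e)"
    using insert by (simp add: mult_ac)
  then show ?case using bc by metis
qed (auto intro: exI[of _ 1])

context odd_length
begin

lemma prim_unit: "e \<in> prims \<Longrightarrow> U * e = e"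
  by (rule primsD)

lemma X_pow_mult_fixed: "X ^ i * a = a \<Longrightarrow> X ^ (i * k) * a = a"
  by (induction k) (simp_all add: power_add mult.assoc)

lemma X_pow_prim_eqI:
  assumes e: "e \<in> prims" and "2 * (X ^ j * e) = 2 * e"
  shows "X ^ j * e = e"
proof -
  have "(X ^ j * e) * (X ^ j * e) = e * e"
  proof (rule square_eqI)
    show "U * (X ^ j * e) = X ^ j * e" using prim_unit[OF e] by (metis mult.left_commute)
  qed (use assms prim_unit in auto)
  moreover have "(X ^ j * e) * (X ^ j * e) = X ^ (j * 2) * (e * e)"
    by (simp add: power_mult power2_eq_square mult_ac)
  ultimately have 2: "X ^ (j * 2) * e = e" using primsD[OF e] by simp
  obtain k where k: "n = 2 * k + 1" using n_odd by (rule oddE)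
  have "X ^ j * e = X ^ j * (X ^ (j * 2 * k) * e)" using X_pow_mult_fixed[OF 2, of k] by simp
  also have "\<dots> = X ^ (j * n) * e" unfolding k by (simp add: power_add algebra_simps)
  also have "\<dots> = X ^ 0 * e" by (rule X_pow_cong) (simp_all add: cong_def prim_unit[OF e])
  finally show ?thesis by simp
qed

text \<open>On each \<open>Ae\<close> the element \<open>X ^ j - 1\<close> is zero or invertible: if
  it were merely divisible by 2, \<open>X_pow_prim_eqI\<close> would make it zero.\<close>

lemma fixed_eq_ann_ideal:
  "{a. U * a = a \<and> X ^ j * a = a} = ann_ideal (\<lambda>e. if X ^ j * e = e then 2 else 0)"
proof (intro Set.set_eqI iffI)
  fix a assume "a \<in> {a. U * a = a \<and> X ^ j * a = a}"
  then have a: "U * a = a" "X ^ j * a = a" by auto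
  have "a * e = 0" if e: "e \<in> prims" "X ^ j * e \<noteq> e" for e
  proof (rule prim_dichotomy[OF e(1), of "X ^ j - 1"])
    assume "2 * ((X ^ j - 1) * e) = 0"
    then have "2 * (X ^ j * e) = 2 * e" by (simp add: algebra_simps)
    then show ?thesis using X_pow_prim_eqI e by blast
  next
    fix b assume b: "(X ^ j - 1) * b * e = e"
    have "a * e = (X ^ j * a - a) * b * e" by (subst b[symmetric]) (simp add: algebra_simps)
    then show ?thesis using a by simp
  qed
  moreover have "4 * (a * e) = 0" for e using a four_mult[of "a * e"] by (simp add: mult.assoc[symmetric])
  ultimately show "a \<in> ann_ideal (\<lambda>e. if X ^ j * e = e then 2 else 0)" using a by (simp add: ann_ideal_def)
next
  fix a assume a: "a \<in> ann_ideal (\<lambda>e. if X ^ j * e = e then 2 else 0)"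
  then have ua: "U * a = a" by (simp add: ann_ideal_def)
  have "X ^ j * (a * e) = a * e" if e: "e \<in> prims" for e
  proof (cases "X ^ j * e = e")
    case True
    then show ?thesis by (simp add: mult.left_commute)
  next
    case False
    then have "a * e = 0" using a e by (auto simp: ann_ideal_def)
    then show ?thesis by simp
  qed
  then have "X ^ j * (\<Sum>e\<in>prims. a * e) = (\<Sum>e\<in>prims. a * e)" by (simp add: sum_distrib_left)
  then show "a \<in> {a. U * a = a \<and> X ^ j * a = a}" using decompose[OF ua] ua by simp
qed

lemma card_fixed:
  assumes "j dvd n" shows "card {a. U * a = a \<and> X ^ j * a = a} = 16 ^ j"
proof -
  have "{a. U * a = a \<and> X ^ j * a = a} = word ` {c \<in> carrier_vec n. (cyclic_shift ^^ j) c = c}"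
  proof -
    have "X ^ j * word c = word c \<longleftrightarrow> (cyclic_shift ^^ j) c = c" if "c \<in> carrier_vec n" for c
      using word_shift_pow[OF that, of j] word_inj that by (metis inj_onD)
    then show ?thesis by (auto simp: unit_iff_word)
  qed
  moreover have "inj_on word {c \<in> carrier_vec n. (cyclic_shift ^^ j) c = c}"
    by (rule inj_on_subset[OF word_inj]) auto
  ultimately show ?thesis using card_periodic_words[OF assms n_pos] by (simp add: card_image)
qed

text \<open>Double counting of the fixed points of \<open>X ^ j\<close>: there are 16^j periodic
  words, and each \<open>e\<close> with \<open>X ^ j * e = e\<close> contributes a factor
  4^d(e).\<close>

lemma sum_prim_dim_fixed:
  assumes "j dvd n" shows "(\<Sum>e | e \<in> prims \<and> X ^ j * e = e. prim_dim e) = 2 * j"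
proof -
  have "log 2 (16 ^ j) = log 2 ((2::real) ^ (4 * j))" by (simp add: power_mult)
  also have "\<dots> = 4 * j" by (simp only: log_pow_cancel)
  finally have "4 * j = log 2 (card (ann_ideal (\<lambda>e. if X ^ j * e = e then 2 else 0)))"
    using card_fixed[OF assms] by (simp add: fixed_eq_ann_ideal)
  also have "\<dots> = (\<Sum>e\<in>prims. prim_dim e * real (if X ^ j * e = e then 2 else 0))"
    by (rule log_card_ann_ideal) simp
  also have "\<dots> = (\<Sum>e\<in>prims. if X ^ j * e = e then 2 * prim_dim e else 0)"
    by (rule sum.cong) auto
  also have "\<dots> = (\<Sum>e | e \<in> prims \<and> X ^ j * e = e. 2 * prim_dim e)"
    by (rule sum.inter_filter[OF prims_finite, symmetric])
  also have "\<dots> = 2 * (\<Sum>e | e \<in> prims \<and> X ^ j * e = e. prim_dim e)"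
    by (rule sum_distrib_left[symmetric])
  finally show ?thesis by simp
qed

section \<open>Orders of x on the components\<close>

definition prim_ord :: "cyc \<Rightarrow> nat" where
  "prim_ord e = (LEAST k. k > 0 \<and> X ^ k * e = e)"

lemma X_pow_prim_iff:
  assumes e: "e \<in> prims" shows "X ^ j * e = e \<longleftrightarrow> prim_ord e dvd j"
proof -
  have "X ^ n * e = e" using prim_unit[OF e] by (simp add: X_pow_n)
  then have "prim_ord e > 0 \<and> X ^ prim_ord e * e = e"
    unfolding prim_ord_def using n_pos by (intro LeastI[of "\<lambda>k. k > 0 \<and> X ^ k * e = e" n] conjI)
  then have pos: "prim_ord e > 0" and fixed: "X ^ prim_ord e * e = e" by auto
  have "X ^ j * e = X ^ (j mod prim_ord e) * (X ^ (prim_ord e * (j div prim_ord e)) * e)"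
    by (simp add: mult.assoc[symmetric] power_add[symmetric])
  then have j: "X ^ j * e = X ^ (j mod prim_ord e) * e" using X_pow_mult_fixed[OF fixed] by simp
  show ?thesis
  proof
    assume "X ^ j * e = e"
    then have "\<not> j mod prim_ord e > 0"
      using j pos not_less_Least[of "j mod prim_ord e" "\<lambda>k. k > 0 \<and> X ^ k * e = e"]
      by (auto simp: prim_ord_def)
    then show "prim_ord e dvd j" by auto
  qed (use j in auto)
qed

lemma prim_ord_dvd: "e \<in> prims \<Longrightarrow> prim_ord e dvd n"
  using X_pow_prim_iff[of e n] prim_unit[of e] by (simp add: X_pow_n)

text \<open>Summed over the divisors of \<open>j\<close>, both sides give \<open>2 * j\<close>;
  strong induction takes the place of Moebius inversion.\<close>

lemma sum_prim_dim_ord: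
  assumes "j dvd n" shows "(\<Sum>e | e \<in> prims \<and> prim_ord e = j. prim_dim e) = 2 * totient j"
  using assms
proof (induction j rule: less_induct)
  case (less j)
  let ?\<psi> = "\<lambda>k. \<Sum>e | e \<in> prims \<and> prim_ord e = k. prim_dim e"
  have j: "j > 0" using less.prems n_pos by (auto simp: dvd_pos_nat)
  have fin: "finite {k. k dvd j}" using j by simp
  have "(\<Sum>e | e \<in> prims \<and> prim_ord e dvd j. prim_dim e) =
      (\<Sum>k | k dvd j. \<Sum>e | e \<in> {e \<in> prims. prim_ord e dvd j} \<and> prim_ord e = k. prim_dim e)"
    by (rule sum.group[symmetric]) (use prims_finite fin in auto)
  also have "\<dots> = (\<Sum>k | k dvd j. ?\<psi> k)"
    by (rule sum.cong) (auto intro!: sum.cong)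
  finally have "(\<Sum>k | k dvd j. ?\<psi> k) = 2 * real j"
    using sum_prim_dim_fixed[OF less.prems] X_pow_prim_iff by (simp cong: conj_cong)
  moreover have "(\<Sum>k | k dvd j. ?\<psi> k) = ?\<psi> j + (\<Sum>k\<in>{k. k dvd j} - {j}. ?\<psi> k)"
    by (rule sum.remove) (use fin in auto)
  moreover have "(\<Sum>k\<in>{k. k dvd j} - {j}. ?\<psi> k) = (\<Sum>k\<in>{k. k dvd j} - {j}. 2 * real (totient k))"
  proof (rule sum.cong[OF refl])
    fix k assume k: "k \<in> {k. k dvd j} - {j}"
    then have "k < j" using j by (auto dest: dvd_imp_le)
    then show "?\<psi> k = 2 * real (totient k)" using less.IH[of k] k less.prems dvd_trans by auto
  qed
  moreover have "(\<Sum>k | k dvd j. 2 * real (totient k)) = 2 * real j"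
  proof -
    have "(\<Sum>k | k dvd j. 2 * real (totient k)) = 2 * real (\<Sum>k | k dvd j. totient k)"
      by (simp add: sum_distrib_left)
    then show ?thesis by (simp add: totient_divisor_sum)
  qed
  moreover have "(\<Sum>k | k dvd j. 2 * real (totient k)) =
      2 * real (totient j) + (\<Sum>k\<in>{k. k dvd j} - {j}. 2 * real (totient k))"
    by (rule sum.remove) (use fin in auto)
  ultimately show ?case by simp
qed

section \<open>Components fixed by inversion\<close>

text \<open>Modulo 2 the substitution raises \<open>e\<close> to a power, which is \<open>e\<close>
  again, and idempotents congruent modulo 2 are equal.\<close>

lemma subst_two_pow_prim:
  assumes e: "e \<in> prims" shows "subst_pow (2 ^ i) e = e"
proof (rule idem_eqI)
  have "e ^ Suc k = e" for k by (induction k) (simp_all add: primsD[OF e])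
  then have "e ^ 2 ^ i = e" by (metis gr0_implies_Suc zero_less_numeral zero_less_power)
  then show "2 * subst_pow (2 ^ i) e = 2 * e" using frobenius[OF prim_unit[OF e], of i] by simp
  show "subst_pow (2 ^ i) e * subst_pow (2 ^ i) e = subst_pow (2 ^ i) e"
    by (simp add: subst_pow.hom_mult[symmetric] primsD[OF e])
qed (simp_all add: subst_unit primsD[OF e])

lemma X_pow_pos_cong:
  assumes "[i = j] (mod n)" "i > 0" "j > 0" shows "X ^ i = X ^ j"
proof -
  have "X ^ k * U = X ^ k" if k: "k > 0" for k
  proof -
    obtain m where m: "k = Suc m" using k gr0_implies_Suc by blast
    have "X ^ k * U = X ^ m * (U * X)" unfolding m by (simp only: power_Suc mult_ac)
    then show ?thesis using m by (simp only: U_X power_Suc2)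
  qed
  then show ?thesis using X_pow_cong[OF assms(1) UU] assms(2,3) by simp
qed

lemma subst_X_pos:
  assumes "k > 0" shows "subst_pow k X = X ^ k"
proof -
  obtain m where "k = Suc m" using assms gr0_implies_Suc by blast
  then show ?thesis using U_X by (metis mult.assoc power_Suc subst_X)
qed

lemma inverse_X: "subst_pow (n - 1) X * X = U"
  using n_pos by (simp add: subst_X mult.assoc power_Suc2[symmetric] X_pow_n UU del: power_Suc)

text \<open>On \<open>Ae\<close> the inverse of x is x^(2^i), so inversion and a Frobenius power
  send \<open>e\<close> to elements with the same \<open>e\<close>-part. Frobenius fixes
  \<open>e\<close>, and distinct primitive idempotents are orthogonal.\<close>

lemma self_inverse_primI:
  assumes e: "e \<in> prims" and i: "X ^ (2 ^ i + 1) * e = e"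
  shows "subst_pow (n - 1) e = e"
proof (rule ccontr)
  assume ne: "subst_pow (n - 1) e \<noteq> e"
  have "X ^ (n - 1) * e = X ^ (n - 1) * (X ^ (2 ^ i + 1) * e)" by (simp only: i)
  also have "\<dots> = X ^ (n - 1 + (2 ^ i + 1)) * e" by (simp only: power_add mult.assoc)
  also have "\<dots> = X ^ 2 ^ i * e"
    using n_pos by (intro X_pow_cong prim_unit e) (simp add: cong_def)
  finally have "subst_pow (2 ^ i) e * e = subst_pow (n - 1) e * e"
    by (intro subst_pow_eqI prim_unit e) simp
  then have "e = subst_pow (n - 1) e * e" by (simp add: subst_two_pow_prim[OF e] primsD[OF e])
  then show False using prims_orth[OF \<sigma>_prims[OF e] e ne] primsD(3)[OF e] by simp
qed

text \<open>Modulo 2 and on the component of \<open>e\<close>, the coefficients of the polynomial \<open>G\<close> below are fixed by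
  the Frobenius map, hence lie in the prime field and are fixed by \<open>x \<mapsto> x\<^sup>-\<^sup>1\<close>. So \<open>x\<^sup>-\<^sup>1\<close> is a root
  of \<open>G\<close> as well, that is, a Frobenius conjugate of \<open>x\<close>.\<close>

lemma self_inverse_primD:
  assumes e: "e \<in> prims" and inv: "subst_pow (n - 1) e = e"
  shows "\<exists>i>0. X ^ (2 ^ i + 1) * e = e"
proof (rule ccontr)
  assume no: "\<not> (\<exists>i>0. X ^ (2 ^ i + 1) * e = e)"
  define m where "m = totient n"
  have m: "m > 0" using n_pos by (simp add: m_def)
  \<comment> \<open>The roots are the Frobenius conjugates of \<open>X\<close> with exponents 2^1 to
    2^m. Starting at 1 keeps the index positive, as in \<open>no\<close>; \<open>X\<close> itself is
    the last root, as 2^m = 1 modulo n.\<close>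
  define G where "G = (\<Prod>i<m. [:- (X ^ 2 ^ Suc i), 1:])"
  interpret \<phi>: map_poly_comm_ring_hom "subst_pow 2" ..
  have "map_poly (subst_pow 2) G = (\<Prod>i<m. [:- (X ^ 2 ^ Suc (Suc i)), 1:])"
    unfolding G_def
    by (simp add: \<phi>.hom_prod subst_pow.hom_uminus subst_pow.hom_power subst_X_pos power_mult[symmetric])
  \<comment> \<open>Frobenius permutes the linear factors cyclically, the last one wrapping around
    to the first.\<close>
  also have "\<dots> = (\<Prod>i<m. [:- (X ^ 2 ^ Suc ((i + 1) mod m)), 1:])"
  proof (rule prod.cong[OF refl])
    fix i assume "i \<in> {..<m}"
    show "[:- (X ^ 2 ^ Suc (Suc i)), 1:] = [:- (X ^ 2 ^ Suc ((i + 1) mod m)), 1:]"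
    proof (cases "Suc i = m")
      case True
      have "[2 * 2 ^ m = 2 * 1] (mod n)" unfolding m_def by (intro cong_mult two_pow_totient_cong) simp
      then have "X ^ (2 * 2 ^ m) = X ^ (2 * 1)" by (rule X_pow_pos_cong) simp_all
      then show ?thesis using True by simp
    qed (use \<open>i \<in> {..<m}\<close> in simp)
  qed
  also have "\<dots> = G" unfolding G_def by (rule prod.reindex_bij_betw[OF bij_betw_add_mod[OF m]])
  finally have "map_poly (subst_pow 2) G = G" .
  then have coeff_G: "subst_pow 2 (coeff G k) = coeff G k" for k
    by (metis coeff_map_poly subst_pow.hom_zero)
  have coeff: "2 * e * subst_pow (n - 1) (coeff G k) = 2 * e * coeff G k" for k
  proof -
    define b where "b = coeff G k * e"
    have Ub: "U * b = b" unfolding b_def using prim_unit[OF e] by (metis mult.left_commute)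
    have inv_b: "2 * e * subst_pow (n - 1) (coeff G k) = subst_pow (n - 1) (2 * b)"
    proof -
      have "subst_pow (n - 1) (2 * b) = 2 * (subst_pow (n - 1) (coeff G k) * e)"
        using \<sigma>_two[of 1 b] by (simp only: power_one_right) (simp only: b_def subst_pow.hom_mult inv)
      then show ?thesis by (simp only: mult_ac)
    qed
    \<comment> \<open>Being fixed by Frobenius, \<open>b\<close> is idempotent modulo 2, hence
      congruent to 0 or \<open>e\<close>, and inversion fixes both.\<close>
    have "subst_pow (n - 1) (2 * b) = 2 * b"
    proof (rule prim_dichotomy[OF e, of "coeff G k"])
      assume "2 * (coeff G k * e) = 0"
      then show ?thesis by (simp add: b_def)
    next
      fix d assume d: "coeff G k * d * e = e"
      have "subst_pow (2 ^ 1) b = b"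
        using subst_two_pow_prim[OF e, of 1] by (simp add: b_def subst_pow.hom_mult coeff_G)
      then have bb: "2 * b = 2 * (b * b)" using frobenius[OF Ub, of 1] by (simp add: power2_eq_square)
      have bd: "b * d = e" using d by (simp add: b_def mult_ac)
      have "2 * e = 2 * b * d" by (simp add: bd mult.assoc)
      also have "\<dots> = 2 * (b * (b * d))" unfolding bb by (simp only: mult_ac)
      also have "\<dots> = 2 * b" using primsD(2)[OF e] unfolding bd by (simp add: b_def mult.assoc)
      finally have "2 * b = 2 * e" ..
      then show ?thesis using \<sigma>_two[of 1 e] inv by simp
    qed
    then show ?thesis unfolding inv_b by (simp add: b_def mult_ac)
  qed
  have "smult (2 * e) (map_poly (subst_pow (n - 1)) G) = smult (2 * e) G"
    by (rule poly_eqI) (simp only: coeff_smult subst_pow.coeff_map_poly_hom coeff)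
  then have "2 * e * poly G (subst_pow (n - 1) X) = 2 * e * subst_pow (n - 1) (poly G X)"
    by (metis poly_smult subst_pow.poly_map_poly)
  also have "poly G X = 0"
  proof -
    have "X ^ 2 ^ m = X ^ 1" unfolding m_def by (rule X_pow_pos_cong[OF two_pow_totient_cong]) simp_all
    then have "poly [:- (X ^ 2 ^ Suc (m - 1)), 1:] X = 0"
      unfolding Suc_diff_1[OF m] by simp
    moreover have "m - 1 \<in> {..<m}" using m by simp
    ultimately show ?thesis unfolding G_def poly_prod by (intro prod_zero bexI finite_lessThan)
  qed
  finally have root: "2 * e * poly G (subst_pow (n - 1) X) = 0" by simp
  \<comment> \<open>If x^-1 were congruent to a conjugate of x modulo 2 on \<open>Ae\<close>, then
    some \<open>X ^ (2 ^ Suc i + 1)\<close> would fix \<open>e\<close>. So every linear factor is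
    invertible at x^-1, and their product cannot kill \<open>2 * e\<close>.\<close>
  have "\<exists>b. (subst_pow (n - 1) X - X ^ 2 ^ Suc i) * b * e = e" for i
  proof (rule prim_dichotomy[OF e, of "subst_pow (n - 1) X - X ^ 2 ^ Suc i"])
    assume z: "2 * ((subst_pow (n - 1) X - X ^ 2 ^ Suc i) * e) = 0"
    have "2 * (X ^ (2 ^ Suc i + 1) * e) = 2 * ((subst_pow (n - 1) X * X) * e)
        - X * (2 * ((subst_pow (n - 1) X - X ^ 2 ^ Suc i) * e))"
      by (simp add: algebra_simps)
    then have "2 * (X ^ (2 ^ Suc i + 1) * e) = 2 * e" unfolding z inverse_X by (simp add: prim_unit[OF e])
    then show ?thesis using X_pow_prim_eqI[OF e] no by blast
  qed blast
  then obtain b where b: "(\<Prod>i<m. subst_pow (n - 1) X - X ^ 2 ^ Suc i) * b * e = e"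
    using prod_prim_unit[OF e] by metis
  have "poly G (subst_pow (n - 1) X) = (\<Prod>i<m. subst_pow (n - 1) X - X ^ 2 ^ Suc i)"
    by (simp add: G_def poly_prod)
  with b have "2 * e = 2 * e * poly G (subst_pow (n - 1) X) * b" by (metis mult.assoc mult.commute)
  then show False using root two_prim_nonzero[OF e] by simp
qed

lemma self_inverse_prim_iff:
  assumes "e \<in> prims" shows "subst_pow (n - 1) e = e \<longleftrightarrow> prim_ord e \<in> N2"
proof -
  have "subst_pow (n - 1) e = e \<longleftrightarrow> (\<exists>i>0. prim_ord e dvd 2 ^ i + 1)"
    using self_inverse_primI[OF assms] self_inverse_primD[OF assms] X_pow_prim_iff[OF assms] by blast
  moreover have "prim_ord e \<ge> 1" using prim_ord_dvd[OF assms] n_pos by (simp add: Suc_leI dvd_pos_nat)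
  ultimately show ?thesis by (simp add: N2_def)
qed

section \<open>Summation of the degrees\<close>

lemma sum_prim_dim: "(\<Sum>e\<in>prims. prim_dim e) = 2 * n"
proof -
  have "{e. e \<in> prims \<and> X ^ n * e = e} = prims" using prim_unit by (auto simp: X_pow_n)
  then show ?thesis using sum_prim_dim_fixed[of n] by simp
qed

lemma sum_prim_dim_self_inverse:
  "(\<Sum>e | e \<in> prims \<and> subst_pow (n - 1) e = e. prim_dim e) = 2 * real (B_sum n)"
proof -
  let ?S = "{e. e \<in> prims \<and> subst_pow (n - 1) e = e}" and ?D = "{j. j dvd n \<and> j \<in> N2}"
  have "(\<Sum>e\<in>?S. prim_dim e) = (\<Sum>j\<in>?D. \<Sum>e | e \<in> ?S \<and> prim_ord e = j. prim_dim e)"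
    by (rule sum.group[symmetric]) (use prims_finite n_pos prim_ord_dvd self_inverse_prim_iff in auto)
  also have "\<dots> = (\<Sum>j\<in>?D. 2 * real (totient j))"
  proof (rule sum.cong[OF refl])
    fix j assume j: "j \<in> ?D"
    then have "{e. e \<in> ?S \<and> prim_ord e = j} = {e. e \<in> prims \<and> prim_ord e = j}"
      using self_inverse_prim_iff by auto
    then show "(\<Sum>e | e \<in> ?S \<and> prim_ord e = j. prim_dim e) = 2 * real (totient j)"
      using sum_prim_dim_ord j by simp
  qed
  finally show ?thesis by (simp only: B_sum_def of_nat_sum sum_distrib_left)
qed

end

theorem theorem5p2:
  fixes n :: nat
  assumes "n > 0" and "odd n"
  shows "avg_hull_dim n = 10 * real n / 9 - 4 * real (B_sum n) / 9"
proof -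
  interpret odd_length n by standard (use assms in auto)
  \<comment> \<open>The weight 1/3 is written as 5/9 - 2/9, so the fixed components enter as a
    correction to the sum over all.\<close>
  have "avg_hull_dim n = (\<Sum>e\<in>prims. 5 / 9 * prim_dim e - 2 / 9 * (if subst_pow (n - 1) e = e then prim_dim e else 0))"
    unfolding avg_hull_dim_prims by (rule sum.cong) auto
  also have "\<dots> = 5 / 9 * (\<Sum>e\<in>prims. prim_dim e)
      - 2 / 9 * (\<Sum>e | e \<in> prims \<and> subst_pow (n - 1) e = e. prim_dim e)"
    by (simp only: sum_subtractf sum_distrib_left[symmetric] sum.inter_filter[OF prims_finite])
  also have "\<dots> = 10 * real n / 9 - 4 * real (B_sum n) / 9"
    unfolding sum_prim_dim sum_prim_dim_self_inverse by simp
  finally show ?thesis .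
qed

end
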